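(* There exist absolute positive constants $C, c$ such that for every $n \in \mathbb{N}$, every integer $k \ge 2$, every $\alpha > 0$ and every $p \in \Delta^{k-1}_{\alpha}$ (where $\alpha$ may depend on $n$ and $k$), $$\log \mathbb{E}\left[e^{t\left(Z_{n,k,p} - \mathbb{E}[Z_{n,k,p}]\right)}\right] \le C k \log^4\left(\frac{k}{\alpha}\right) t^2 \quad \text{for all real } t \text{ with } |t| \le \frac{1}{c}.$$
   Context: $\mathbb{N} = \{1,2,\dots\}$; all logarithms are natural and $\log^4(x)$ means $(\log x)^4$. For an integer $k \ge 2$, $\Delta^{k-1} = \{p = (p_1,\dots,p_k) : p_i \ge 0, \sum_{i=1}^k p_i = 1\}$ is the probability simplex, and for $\alpha > 0$, $\Delta^{k-1}_{\alpha} = \{p \in \Delta^{k-1} : \min_{1\le i \le k} p_i \ge \alpha\}$. For $n \in \mathbb{N}$ let $(X_1,\dots,X_k) \sim \mathrm{Multinomial}(n,p)$ and $\widehat{p}_{n,k} = (\widehat p_1,\dots,\widehat p_k) = (X_1/n,\dots,X_k/n)$ (the empirical distribution of $n$ i.i.d. samples from $p$). The relative entropy is $D(\widehat{p}_{n,k}\|p) = \sum_{i=1}^k \widehat p_i \log(\widehat p_i/p_i)$, with terms having $\widehat p_i = 0$ equal to $0$, and $Z_{n,k,p} := 2n D(\widehat{p}_{n,k}\|p)$. *)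

theory Defs
  imports "HOL-Probability.Probability"
begin

(* Vectors (p_1,...,p_k) are functions on nat of which only the values on {1..k} matter. *)

definition prob_simplex :: "nat \<Rightarrow> (nat \<Rightarrow> real) set" where
  "prob_simplex k = {p. (\<forall>i\<in>{1..k}. 0 \<le> p i) \<and> (\<Sum>i=1..k. p i) = 1}"

definition prob_simplex_ge :: "nat \<Rightarrow> real \<Rightarrow> (nat \<Rightarrow> real) set" where
  "prob_simplex_ge k \<alpha> = {p \<in> prob_simplex k. \<alpha> \<le> Min (p ` {1..k})}"

(* Meaningful only for p in prob_simplex k; see pmf_categorical. *)
definition categorical_pmf :: "nat \<Rightarrow> (nat \<Rightarrow> real) \<Rightarrow> nat pmf" where
  "categorical_pmf k p = embed_pmf (\<lambda>i. if i \<in> {1..k} then p i else 0)"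

lemma pmf_categorical:
  assumes "p \<in> prob_simplex k"
  shows "pmf (categorical_pmf k p) i = (if i \<in> {1..k} then p i else 0)"
  unfolding categorical_pmf_def
proof (rule pmf_embed_pmf)
  show "0 \<le> (if i \<in> {1..k} then p i else 0)" for i
    using assms by (auto simp: prob_simplex_def)
  have "(\<integral>\<^sup>+ i. ennreal (if i \<in> {1..k} then p i else 0) \<partial>count_space UNIV)
      = (\<Sum>i=1..k. ennreal (if i \<in> {1..k} then p i else 0))"
    by (rule nn_integral_count_space') auto
  also have "\<dots> = (\<Sum>i=1..k. ennreal (p i))"
    by (rule sum.cong) auto
  also have "\<dots> = ennreal (\<Sum>i=1..k. p i)"
    using assms by (intro sum_ennreal) (auto simp: prob_simplex_def)
  also have "\<dots> = 1"
    using assms by (auto simp: prob_simplex_def)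
  finally show "(\<integral>\<^sup>+ i. ennreal (if i \<in> {1..k} then p i else 0) \<partial>count_space UNIV) = 1" .
qed

(* Joint law of the counts X_i among n independent samples from p. *)
definition multinomial_pmf :: "nat \<Rightarrow> nat \<Rightarrow> (nat \<Rightarrow> real) \<Rightarrow> (nat \<Rightarrow> nat) pmf" where
  "multinomial_pmf n k p =
     map_pmf (\<lambda>\<omega> i. card {j \<in> {1..n}. \<omega> j = i})
       (Pi_pmf {1..n} undefined (\<lambda>_. categorical_pmf k p))"

definition empirical :: "nat \<Rightarrow> (nat \<Rightarrow> nat) \<Rightarrow> nat \<Rightarrow> real" where
  "empirical n X i = real (X i) / real n"

definition rel_entropy :: "nat \<Rightarrow> (nat \<Rightarrow> real) \<Rightarrow> (nat \<Rightarrow> real) \<Rightarrow> real" where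
  "rel_entropy k q p = (\<Sum>i=1..k. if q i = 0 then 0 else q i * ln (q i / p i))"

(* A random variable on the space of count vectors distributed as multinomial_pmf n k p. *)
definition Z_stat :: "nat \<Rightarrow> nat \<Rightarrow> (nat \<Rightarrow> real) \<Rightarrow> (nat \<Rightarrow> nat) \<Rightarrow> real" where
  "Z_stat n k p X = 2 * real n * rel_entropy k (empirical n X) p"

end

theory Submission
  imports Defs
begin

text \<open>
  Write \<open>Z = 2 n D(\<dots>)\<close> as a sum \<open>\<Sum>\<^sub>i \<phi>\<^sub>i (X\<^sub>i)\<close> of nonnegative functions of the single counts; this is
  possible because the counts add up to \<open>n\<close>, so that each term \<open>X\<^sub>i ln (X\<^sub>i / (n p\<^sub>i))\<close> may be completed
  to the Poisson deviance \<open>\<phi>\<^sub>i\<close>. Put \<open>L = ln (k / \<alpha>) \<ge> 1\<close> and let \<open>M\<close> be the moment generating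
  function of \<open>Z\<close>. Two estimates carry the proof.

  The first is crude and free of \<open>p\<close>: \<open>M (1/4) \<le> 2 ^ k\<close> (lemma \<open>mgf_quarter_le\<close>). The factor
  \<open>exp (Z / 4)\<close> turns the multinomial sum into a sum of products \<open>\<Prod>\<^sub>i sqrt (p\<^sub>i x\<^sub>i) ^ x\<^sub>i\<close>. Two
  categories of masses \<open>p\<close> and \<open>q\<close> can be merged into one of mass \<open>p + q\<close> at the price of a factor \<open>2\<close>
  (lemma \<open>binomial_sqrt_sum_le\<close>): the inequality of the means makes the factors linear in the counts,
  and Abel's binomial identity evaluates the resulting sum. The crude bound settles
  \<open>\<bar>t\<bar> > 1 / (8 L)\<close>, where the right-hand side \<open>C k L\<^sup>4 t\<^sup>2\<close> already exceeds \<open>k\<close>.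

  The second is for \<open>\<bar>t\<bar> \<le> 1 / (8 L)\<close> and is the entropy method. Entropy is subadditive over the \<open>n\<close>
  independent samples, and the contribution of one sample is controlled by the change of \<open>Z\<close> when
  that sample is deleted. Deleting a sample from a category with count \<open>x\<close> changes \<open>Z\<close> by about
  \<open>2 ln (x / (n p))\<close>, and the sum over all samples of the squares of these changes is at most a
  multiple of \<open>L (Z + k)\<close>. In the sharper form that the exponential weights require, this is lemma
  \<open>count_times_psi_increment_le\<close>, and it gives
  \<open>t M'(t) - M(t) ln M(t) \<le> C L t\<^sup>2 (M'(t) + k M(t))\<close>.
  The crude bound and convexity of \<open>ln M\<close> give \<open>M' \<le> 12 k M\<close> for \<open>\<bar>t\<bar> \<le> 1/8\<close>, so the right-hand side is at
  most a multiple of \<open>k L t\<^sup>2 M\<close>. Dividing by \<open>t\<^sup>2 M\<close> bounds the derivative of \<open>ln M(t) / t\<close>, and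
  integrating from \<open>0\<close> (Herbst's argument) yields \<open>ln M(t) \<le> t E Z + C k L t\<^sup>2\<close>.

  The law of the counts is handled through the operator \<open>T F x = \<Sum>\<^sub>a p\<^sub>a F (x + e\<^sub>a)\<close>, the expectation
  of \<open>F\<close> after one more sample: the multinomial expectation of \<open>F\<close> is \<open>T ^^ n\<close> applied to \<open>F\<close>
  at \<open>0\<close>. As the samples are exchangeable, subadditivity of entropy and the sum over the samples
  become statements about powers of \<open>T\<close> that are proved by induction.
\<close>

section \<open>Abel's binomial identity\<close>

lemma sum_binomial_Suc:
  fixes g :: "nat \<Rightarrow> real"
  shows "(\<Sum>x\<le>Suc n. real (Suc n choose x) * g x) = (\<Sum>x\<le>n. real (n choose x) * (g x + g (Suc x)))"
proof -
  have "(\<Sum>x\<le>Suc n. real (Suc n choose x) * g x)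
      = g 0 + (\<Sum>x\<le>n. real ((n choose x) + (n choose Suc x)) * g (Suc x))"
    by (subst sum.atMost_Suc_shift) (simp add: add.commute flip: of_nat_add)
  also have "\<dots> = (\<Sum>x\<le>n. real (n choose x) * g (Suc x)) + (g 0 + (\<Sum>x\<le>n. real (n choose Suc x) * g (Suc x)))"
    by (simp add: algebra_simps sum.distrib)
  also have "g 0 + (\<Sum>x\<le>n. real (n choose Suc x) * g (Suc x)) = (\<Sum>x\<le>Suc n. real (n choose x) * g x)"
    by (subst sum.atMost_Suc_shift) simp
  also have "\<dots> = (\<Sum>x\<le>n. real (n choose x) * g x)"
    by simp
  finally show ?thesis by (simp add: algebra_simps sum.distrib)
qed

text \<open>An \<open>n\<close>-th finite difference annihilates polynomials of degree below \<open>n\<close>.\<close>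

lemma alternating_binomial_power_sum:
  fixes c :: real
  assumes "m < n"
  shows "(\<Sum>x\<le>n. real (n choose x) * ((-1) ^ x * (c - real x) ^ m)) = 0"
  using assms
proof (induction n arbitrary: m c)
  case (Suc n)
  have diff: "(c - real x) ^ m - (c - real (Suc x)) ^ m
      = (\<Sum>l<m. real (m choose l) * (c - 1 - real x) ^ l)" for x
  proof -
    have "(c - real x) ^ m = ((c - 1 - real x) + 1) ^ m" by simp
    also have "\<dots> = (\<Sum>l\<le>m. real (m choose l) * (c - 1 - real x) ^ l)"
      by (subst binomial_ring) simp
    also have "\<dots> = (\<Sum>l<m. real (m choose l) * (c - 1 - real x) ^ l) + (c - 1 - real x) ^ m"
      by (simp flip: lessThan_Suc_atMost)
    finally show ?thesis by (simp add: algebra_simps)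
  qed
  have "(\<Sum>x\<le>Suc n. real (Suc n choose x) * ((-1) ^ x * (c - real x) ^ m))
      = (\<Sum>x\<le>n. real (n choose x) * ((-1) ^ x * ((c - real x) ^ m - (c - real (Suc x)) ^ m)))"
    by (subst sum_binomial_Suc) (simp add: algebra_simps)
  also have "\<dots> = (\<Sum>x\<le>n. \<Sum>l<m. real (m choose l) * (real (n choose x) * ((-1) ^ x * (c - 1 - real x) ^ l)))"
    unfolding diff by (simp add: sum_distrib_left algebra_simps)
  also have "\<dots> = (\<Sum>l<m. real (m choose l) * (\<Sum>x\<le>n. real (n choose x) * ((-1) ^ x * (c - 1 - real x) ^ l)))"
    by (subst sum.swap) (simp add: sum_distrib_left)
  also have "\<dots> = 0"
  proof (intro sum.neutral ballI)
    fix l assume "l \<in> {..<m}"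
    then have "l < n" using Suc.prems by simp
    have "(\<Sum>x\<le>n. real (n choose x) * ((-1) ^ x * (c - 1 - real x) ^ l)) = 0"
      by (rule Suc.IH[OF \<open>l < n\<close>])
    then show "real (m choose l) * (\<Sum>x\<le>n. real (n choose x) * ((-1) ^ x * (c - 1 - real x) ^ l)) = 0"
      by simp
  qed
  finally show ?case .
qed simp

text \<open>The value \<open>b (b + m) ^ (m - 1)\<close>, where the exponent \<open>-1\<close> at \<open>m = 0\<close> is read so that the factors cancel to \<open>1\<close>.\<close>

definition abel_weight :: "real \<Rightarrow> nat \<Rightarrow> real" where
  "abel_weight b m = (if m = 0 then 1 else b * (b + real m) ^ (m - 1))"

text \<open>Both sides are polynomials in \<open>a\<close>. By induction on \<open>n\<close> their derivatives agree, since differentiating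
  the left-hand side gives \<open>n\<close> times the sum for \<open>n - 1\<close> at \<open>a + 1\<close>. They agree at \<open>a = - b - n\<close>, where the
  sum becomes an \<open>n\<close>-th difference of a polynomial of degree \<open>n - 1\<close>.\<close>

lemma abel_identity:
  fixes a b :: real
  shows "(\<Sum>x\<le>n. real (n choose x) * ((a + real x) ^ x * abel_weight b (n - x))) = (a + b + real n) ^ n"
proof (induction n arbitrary: a)
  case 0
  show ?case by (simp add: abel_weight_def)
next
  case (Suc n)
  define f where "f = (\<lambda>a. \<Sum>x\<le>Suc n. real (Suc n choose x) * ((a + real x) ^ x * abel_weight b (Suc n - x)))"
  define g where "g = (\<lambda>a. (a + b + real (Suc n)) ^ Suc n)"
  have f': "(f has_real_derivative real (Suc n) * (a + b + real (Suc n)) ^ n) (at a)" for a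
  proof -
    have "(f has_real_derivative
        (\<Sum>x\<le>Suc n. real (Suc n choose x) * (real x * (a + real x) ^ (x - 1) * abel_weight b (Suc n - x)))) (at a)"
      unfolding f_def
    proof (rule DERIV_sum)
      fix x
      show "((\<lambda>a. real (Suc n choose x) * ((a + real x) ^ x * abel_weight b (Suc n - x))) has_real_derivative
          real (Suc n choose x) * (real x * (a + real x) ^ (x - 1) * abel_weight b (Suc n - x))) (at a)"
        by (auto intro!: derivative_eq_intros)
    qed
    also have "(\<Sum>x\<le>Suc n. real (Suc n choose x) * (real x * (a + real x) ^ (x - 1) * abel_weight b (Suc n - x)))
       = (\<Sum>x\<le>n. real (Suc x * (Suc n choose Suc x)) * ((a + 1 + real x) ^ x * abel_weight b (n - x)))"
      by (subst sum.atMost_Suc_shift) (simp add: algebra_simps del: binomial_Suc_Suc)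
    also have "\<dots> = real (Suc n) * (\<Sum>x\<le>n. real (n choose x) * ((a + 1 + real x) ^ x * abel_weight b (n - x)))"
      unfolding Suc_times_binomial by (simp only: sum_distrib_left of_nat_mult mult.assoc)
    also have "\<dots> = real (Suc n) * (a + b + real (Suc n)) ^ n"
      unfolding Suc.IH by (simp add: algebra_simps)
    finally show ?thesis .
  qed
  have g': "(g has_real_derivative real (Suc n) * (a + b + real (Suc n)) ^ n) (at a)" for a
    unfolding g_def by (auto intro!: derivative_eq_intros simp del: power_Suc)
  have "((\<lambda>a. f a - g a) has_real_derivative 0) (at a)" for a
    using DERIV_diff[OF f' g', of a] by simp
  then have const: "f a - g a = f a0 - g a0" for a a0
    by (intro DERIV_isconst_all) auto
  \<comment> \<open>The point where the right-hand side vanishes.\<close>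
  define a0 where "a0 = - b - real (Suc n)"
  have "f a0 = (\<Sum>x\<le>Suc n. b * (real (Suc n choose x) * ((-1) ^ x * (b + real (Suc n) - real x) ^ n)))"
    unfolding f_def
  proof (intro sum.cong refl)
    fix x assume x: "x \<in> {..Suc n}"
    have *: "a0 + real x = - (b + real (Suc n) - real x)" by (simp add: a0_def)
    have eq: "(a0 + real x) ^ x * abel_weight b (Suc n - x) = b * ((-1) ^ x * (b + real (Suc n) - real x) ^ n)"
    proof (cases "x = Suc n")
      case True
      then show ?thesis unfolding * by (simp add: abel_weight_def power_minus')
    next
      case False
      then have "x \<le> n" using x by simp
      define d where "d = b + real (Suc n) - real x"
      have "d ^ n = d ^ x * d ^ (n - x)"
        using \<open>x \<le> n\<close> by (simp flip: power_add)
      moreover have "abel_weight b (Suc n - x) = b * d ^ (n - x)"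
        using \<open>x \<le> n\<close> by (simp add: abel_weight_def d_def of_nat_diff add_diff_eq)
      moreover have "(a0 + real x) ^ x = (-1) ^ x * d ^ x"
        unfolding * d_def by (rule power_minus)
      ultimately show ?thesis unfolding d_def[symmetric] by simp
    qed
    show "real (Suc n choose x) * ((a0 + real x) ^ x * abel_weight b (Suc n - x))
       = b * (real (Suc n choose x) * ((-1) ^ x * (b + real (Suc n) - real x) ^ n))"
      unfolding eq by (rule mult.left_commute)
  qed
  also have "\<dots> = 0"
    by (simp only: sum_distrib_left[symmetric] alternating_binomial_power_sum[OF lessI] mult_zero_right)
  finally have "f a0 = 0" .
  moreover have "g a0 = 0" by (simp add: g_def a0_def)
  ultimately have "f a = g a" using const[of a a0] by simp
  then show ?case unfolding f_def g_def .
qed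

definition abel_sum :: "nat \<Rightarrow> real \<Rightarrow> real \<Rightarrow> real" where
  "abel_sum n a b = (\<Sum>x\<le>n. real (n choose x) * ((a + real x) ^ x * (b + real (n - x)) ^ (n - x)))"

text \<open>By the absorption identity for binomial coefficients, the difference of the two sums is the sum
  evaluated by Abel's identity.\<close>

lemma abel_sum_Suc:
  "abel_sum (Suc n) a b = (a + b + real (Suc n)) ^ Suc n + real (Suc n) * abel_sum n a (b + 1)"
proof -
  have absorb: "real (Suc n) * real (n choose x) = real (Suc n choose x) * real (Suc n - x)" if "x \<le> n" for x
  proof -
    have "(Suc n - x) * (Suc n choose x) = Suc n * (n choose x)"
      using binomial_absorb_comp[of "Suc n" x] by simp
    then show ?thesis by (metis mult.commute of_nat_mult)
  qed
  have pow: "(b + real (Suc n - x)) ^ (Suc n - x) - real (Suc n - x) * (b + 1 + real (n - x)) ^ (n - x)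
      = abel_weight b (Suc n - x)" if "x \<le> n" for x
  proof -
    define m where "m = n - x"
    have m: "n = x + m" using that by (simp add: m_def)
    define y where "y = b + 1 + real m"
    have diffs: "Suc n - x = Suc m" "n - x = m" using m by auto
    have y: "b + real (Suc m) = y" by (simp add: y_def)
    have "y * y ^ m - real (Suc m) * y ^ m = b * y ^ m"
      by (simp only: left_diff_distrib[symmetric]) (simp add: y_def)
    then show ?thesis
      unfolding diffs y y_def[symmetric] power_Suc abel_weight_def by (simp add: y del: of_nat_Suc)
  qed
  have "abel_sum (Suc n) a b - real (Suc n) * abel_sum n a (b + 1)
      = (a + real (Suc n)) ^ Suc n +
        (\<Sum>x\<le>n. real (Suc n choose x) * ((a + real x) ^ x * (b + real (Suc n - x)) ^ (Suc n - x))
           - real (Suc n) * real (n choose x) * ((a + real x) ^ x * (b + 1 + real (n - x)) ^ (n - x)))"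
    unfolding abel_sum_def by (simp add: sum_subtractf sum_distrib_left mult.assoc del: binomial_Suc_Suc of_nat_Suc power_Suc)
  also have "(\<Sum>x\<le>n. real (Suc n choose x) * ((a + real x) ^ x * (b + real (Suc n - x)) ^ (Suc n - x))
           - real (Suc n) * real (n choose x) * ((a + real x) ^ x * (b + 1 + real (n - x)) ^ (n - x)))
      = (\<Sum>x\<le>n. real (Suc n choose x) * ((a + real x) ^ x * abel_weight b (Suc n - x)))"
  proof (intro sum.cong refl)
    fix x assume "x \<in> {..n}"
    then have x: "x \<le> n" by simp
    show "real (Suc n choose x) * ((a + real x) ^ x * (b + real (Suc n - x)) ^ (Suc n - x))
           - real (Suc n) * real (n choose x) * ((a + real x) ^ x * (b + 1 + real (n - x)) ^ (n - x))
        = real (Suc n choose x) * ((a + real x) ^ x * abel_weight b (Suc n - x))"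
      unfolding absorb[OF x] pow[OF x, symmetric] by (simp only: right_diff_distrib mult.assoc mult.left_commute)
  qed
  also have "(a + real (Suc n)) ^ Suc n + \<dots>
      = (\<Sum>x\<le>Suc n. real (Suc n choose x) * ((a + real x) ^ x * abel_weight b (Suc n - x)))"
    by (simp add: abel_weight_def)
  finally show ?thesis unfolding abel_identity by simp
qed

text \<open>The recursion passes from \<open>b\<close> to \<open>b + 1\<close> and from \<open>n\<close> to \<open>n - 1\<close>, so it keeps \<open>w\<close>. Unrolled, it is a
  sum whose consecutive terms have ratio at most \<open>n / w \<le> 1/2\<close>.\<close>

lemma abel_sum_le:
  assumes "a + b + real n = w" "2 * real n \<le> w"
  shows "abel_sum n a b \<le> 2 * w ^ n"
  using assms
proof (induction n arbitrary: b)
  case 0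
  then show ?case by (simp add: abel_sum_def)
next
  case (Suc n)
  have "abel_sum n a (b + 1) \<le> 2 * w ^ n"
    using Suc.prems by (intro Suc.IH) auto
  then have "real (Suc n) * abel_sum n a (b + 1) \<le> real (Suc n) * (2 * w ^ n)"
    by (intro mult_left_mono) auto
  moreover have "real (Suc n) * (2 * w ^ n) \<le> w * w ^ n"
    using mult_right_mono[OF Suc.prems(2), of "w ^ n"] Suc.prems(2) by simp
  ultimately show ?case unfolding abel_sum_Suc Suc.prems(1) by (simp only: power_Suc)
qed

text \<open>This is the cost of merging two categories of masses \<open>p\<close> and \<open>q\<close>. The inequality between the
  geometric and the arithmetic mean bounds \<open>sqrt (p x)\<close> by a multiple of \<open>x + n p / (p + q)\<close>; this gives an
  Abel sum with \<open>a + b = n\<close>, for which the preceding bound has \<open>w = 2 n\<close>.\<close>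

lemma binomial_sqrt_sum_le:
  fixes p q :: real
  assumes "p \<ge> 0" "q > 0"
  shows "(\<Sum>x\<le>n. real (n choose x) * (sqrt (p * real x) ^ x * sqrt (q * real (n - x)) ^ (n - x)))
    \<le> 2 * sqrt ((p + q) * real n) ^ n"
proof (cases "n = 0")
  case False
  define r where "r = p + q"
  define N where "N = real n"
  have r: "r > 0" "N > 0" using assms False by (auto simp: r_def N_def)
  have amgm: "sqrt (v * y) \<le> sqrt (r / N) / 2 * (v * N / r + y)" if "v \<ge> 0" "y \<ge> 0" for v y
  proof -
    have "sqrt (v * y) = sqrt (r / N) * sqrt ((v * N / r) * y)"
      using r by (simp flip: real_sqrt_mult)
    also have "\<dots> \<le> sqrt (r / N) * ((v * N / r + y) / 2)"
      using that r by (intro mult_left_mono arith_geo_mean_sqrt) auto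
    finally show ?thesis by simp
  qed
  have "(\<Sum>x\<le>n. real (n choose x) * (sqrt (p * real x) ^ x * sqrt (q * real (n - x)) ^ (n - x)))
    \<le> (\<Sum>x\<le>n. real (n choose x) * ((sqrt (r / N) / 2 * (p * N / r + real x)) ^ x
          * (sqrt (r / N) / 2 * (q * N / r + real (n - x))) ^ (n - x)))"
    using assms r by (intro sum_mono mult_left_mono mult_mono power_mono amgm) auto
  also have "\<dots> = (sqrt (r / N) / 2) ^ n * abel_sum n (p * N / r) (q * N / r)"
    unfolding abel_sum_def sum_distrib_left
  proof (intro sum.cong refl)
    fix x assume "x \<in> {..n}"
    then have "(sqrt (r / N) / 2) ^ n = (sqrt (r / N) / 2) ^ x * (sqrt (r / N) / 2) ^ (n - x)"
      by (simp flip: power_add)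
    then show "real (n choose x) * ((sqrt (r / N) / 2 * (p * N / r + real x)) ^ x
          * (sqrt (r / N) / 2 * (q * N / r + real (n - x))) ^ (n - x))
       = (sqrt (r / N) / 2) ^ n * (real (n choose x) * ((p * N / r + real x) ^ x * (q * N / r + real (n - x)) ^ (n - x)))"
      by (simp only: power_mult_distrib mult_ac)
  qed
  also have "\<dots> \<le> (sqrt (r / N) / 2) ^ n * (2 * (2 * N) ^ n)"
  proof (intro mult_left_mono abel_sum_le)
    have "p * N / r + q * N / r = N" using r unfolding r_def
      by (simp flip: add_divide_distrib distrib_right)
    then show "p * N / r + q * N / r + real n = 2 * N" by (simp add: N_def)
  qed (use r in \<open>auto simp: N_def\<close>)
  also have "\<dots> = 2 * (sqrt (r / N) * N) ^ n"
    by (simp add: power_mult_distrib power_divide)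
  also have "sqrt (r / N) * N = sqrt (r * N)"
    using r by (simp add: real_sqrt_divide real_sqrt_mult real_div_sqrt field_simps)
  finally show ?thesis by (simp add: r_def N_def)
qed simp

section \<open>Multinomial expectations by adding one sample at a time\<close>

text \<open>For weights that sum to \<open>1\<close> this is the expectation after one more sample. The induction over the
  number of categories applies it to weights that sum to less.\<close>

definition sample_step :: "nat \<Rightarrow> (nat \<Rightarrow> real) \<Rightarrow> ((nat \<Rightarrow> nat) \<Rightarrow> real) \<Rightarrow> (nat \<Rightarrow> nat) \<Rightarrow> real" where
  "sample_step k p F x = (\<Sum>a=1..k. p a * F (x(a := Suc (x a))))"

lemma sample_steps_Suc_apply:
  "(sample_step k p ^^ Suc n) F x = (\<Sum>a=1..k. p a * (sample_step k p ^^ n) F (x(a := Suc (x a))))"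
  by (simp only: funpow.simps o_apply) (rule sample_step_def)

lemma sample_steps_Suc: "(sample_step k p ^^ Suc n) F = (sample_step k p ^^ n) (sample_step k p F)"
  by (simp add: funpow_swap1)

lemma sample_steps_add:
  "(sample_step k p ^^ n) (\<lambda>x. F x + G x) = (\<lambda>x. (sample_step k p ^^ n) F x + (sample_step k p ^^ n) G x)"
  by (induction n) (auto simp: sample_steps_Suc_apply algebra_simps sum.distrib simp del: funpow.simps(2))

lemma sample_steps_cmult:
  "(sample_step k p ^^ n) (\<lambda>x. c * F x) = (\<lambda>x. c * (sample_step k p ^^ n) F x)"
  by (induction n) (auto simp: sample_steps_Suc_apply sum_distrib_left mult.left_commute simp del: funpow.simps(2) intro!: sum.cong)

lemma sample_steps_diff:
  "(sample_step k p ^^ n) (\<lambda>x. F x - G x) = (\<lambda>x. (sample_step k p ^^ n) F x - (sample_step k p ^^ n) G x)"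
  by (induction n) (auto simp: sample_steps_Suc_apply algebra_simps sum_subtractf simp del: funpow.simps(2))

lemma sample_steps_shift:
  "(sample_step k p ^^ n) F (x(a := Suc (x a))) = (sample_step k p ^^ n) (\<lambda>y. F (y(a := Suc (y a)))) x"
proof (induction n arbitrary: x)
  case (Suc n)
  have swap: "(y(a := Suc (y a)))(b := Suc ((y(a := Suc (y a))) b))
      = (y(b := Suc (y b)))(a := Suc ((y(b := Suc (y b))) a))" for y :: "nat \<Rightarrow> nat" and b
    by (auto simp: fun_eq_iff)
  show ?case by (simp only: sample_steps_Suc_apply swap Suc.IH)
qed simp

text \<open>The operator only looks at states that \<open>n\<close> further samples can reach, so a comparison on those
  suffices. This is how the constraint that the counts add up to \<open>n\<close> enters.\<close>

lemma sample_steps_mono: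
  assumes "\<And>i. i \<in> {1..k} \<Longrightarrow> 0 \<le> p i"
    and "\<And>y. (\<Sum>i=1..k. y i) = (\<Sum>i=1..k. x i) + n \<Longrightarrow> F y \<le> G y"
  shows "(sample_step k p ^^ n) F x \<le> (sample_step k p ^^ n) G x"
  using assms(2)
proof (induction n arbitrary: x)
  case (Suc n)
  have "(sample_step k p ^^ n) F (x(a := Suc (x a))) \<le> (sample_step k p ^^ n) G (x(a := Suc (x a)))" if "a \<in> {1..k}" for a
  proof (rule Suc.IH)
    have "(\<Sum>i=1..k. (x(a := Suc (x a))) i) = Suc (\<Sum>i=1..k. x i)"
      using that by (simp add: sum.remove[of _ a])
    then show "F y \<le> G y" if "(\<Sum>i=1..k. y i) = (\<Sum>i=1..k. (x(a := Suc (x a))) i) + n" for y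
      using that Suc.prems[of y] by simp
  qed
  then show ?case
    using assms(1) unfolding sample_steps_Suc_apply by (intro sum_mono mult_left_mono) auto
qed simp

lemma sample_steps_cong:
  assumes "\<And>y. (\<Sum>i=1..k. y i) = (\<Sum>i=1..k. x i) + n \<Longrightarrow> F y = G y"
  shows "(sample_step k p ^^ n) F x = (sample_step k p ^^ n) G x"
  using assms
proof (induction n arbitrary: x)
  case (Suc n)
  have "(sample_step k p ^^ n) F (x(a := Suc (x a))) = (sample_step k p ^^ n) G (x(a := Suc (x a)))" if "a \<in> {1..k}" for a
  proof (rule Suc.IH)
    have "(\<Sum>i=1..k. (x(a := Suc (x a))) i) = Suc (\<Sum>i=1..k. x i)"
      using that by (simp add: sum.remove[of _ a])
    then show "F y = G y" if "(\<Sum>i=1..k. y i) = (\<Sum>i=1..k. (x(a := Suc (x a))) i) + n" for y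
      using that Suc.prems[of y] by simp
  qed
  then show ?case unfolding sample_steps_Suc_apply by (intro sum.cong) auto
qed simp

lemma sample_steps_const:
  assumes "(\<Sum>i=1..k. p i) = 1"
  shows "(sample_step k p ^^ n) (\<lambda>_. c) = (\<lambda>_. c)"
  using assms by (induction n) (auto simp: sample_steps_Suc_apply fun_eq_iff simp del: funpow.simps(2) simp flip: sum_distrib_right)

lemma sample_steps_pos:
  assumes "k \<ge> 1" "\<And>i. i \<in> {1..k} \<Longrightarrow> 0 < p i" "\<And>x. F x > 0"
  shows "(sample_step k p ^^ n) F x > 0"
  using assms by (induction n arbitrary: x) (auto simp: sample_steps_Suc_apply simp del: funpow.simps(2) intro!: sum_pos)

lemma sample_steps_DERIV:
  assumes "\<And>y. ((\<lambda>t. F t y) has_real_derivative F' y) (at t)"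
  shows "((\<lambda>t. (sample_step k p ^^ n) (F t) x) has_real_derivative (sample_step k p ^^ n) F' x) (at t)"
proof (induction n arbitrary: x)
  case 0
  then show ?case using assms by simp
next
  case (Suc n)
  then show ?case
    unfolding sample_steps_Suc_apply by (intro DERIV_sum DERIV_cmult)
qed

lemma multinomial_pmf_Suc:
  "multinomial_pmf (Suc n) k p =
    categorical_pmf k p \<bind> (\<lambda>a. map_pmf (\<lambda>x. x(a := Suc (x a))) (multinomial_pmf n k p))"
proof -
  have "(\<lambda>i. card {j \<in> {1..Suc n}. (f(Suc n := a)) j = i})
      = (\<lambda>i. card {j \<in> {1..n}. f j = i})(a := Suc (card {j \<in> {1..n}. f j = a}))" (is "?l = ?r")
    for a :: nat and f :: "nat \<Rightarrow> nat"
  proof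
    fix i
    have "{j \<in> {1..Suc n}. (f(Suc n := a)) j = i}
        = (if a = i then insert (Suc n) {j \<in> {1..n}. f j = i} else {j \<in> {1..n}. f j = i})"
      by (auto simp: le_Suc_eq)
    then show "?l i = ?r i" by simp
  qed
  note upd = this
  have "Pi_pmf {1..Suc n} undefined (\<lambda>_. categorical_pmf k p)
      = categorical_pmf k p \<bind> (\<lambda>a. map_pmf (\<lambda>f. f(Suc n := a)) (Pi_pmf {1..n} undefined (\<lambda>_. categorical_pmf k p)))"
    unfolding atLeastAtMostSuc_conv[OF le_add1[of 1 n, unfolded plus_1_eq_Suc]] map_pmf_def
    by (rule Pi_pmf_insert') auto
  then show ?thesis
    unfolding multinomial_pmf_def by (simp only: map_bind_pmf pmf.map_comp o_def upd)
qed

lemma set_categorical_pmf_subset: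
  assumes "p \<in> prob_simplex k"
  shows "set_pmf (categorical_pmf k p) \<subseteq> {1..k}"
  using assms by (auto simp: set_pmf_iff pmf_categorical simp del: atLeastAtMost_iff split: if_splits)

lemma finite_set_multinomial_pmf:
  assumes "p \<in> prob_simplex k"
  shows "finite (set_pmf (multinomial_pmf n k p))"
proof (induction n)
  case (Suc n)
  have "finite (set_pmf (categorical_pmf k p))"
    using set_categorical_pmf_subset[OF assms] finite_subset by blast
  then show ?case using Suc by (simp add: multinomial_pmf_Suc)
qed (simp add: multinomial_pmf_def)

lemma expectation_multinomial:
  assumes "p \<in> prob_simplex k"
  shows "measure_pmf.expectation (multinomial_pmf n k p) g = (sample_step k p ^^ n) g (\<lambda>_. 0)"
proof (induction n arbitrary: g)
  case (Suc n)
  have "measure_pmf.expectation (multinomial_pmf (Suc n) k p) g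
      = (\<Sum>a\<in>{1..k}. pmf (categorical_pmf k p) a *\<^sub>R
          measure_pmf.expectation (map_pmf (\<lambda>x. x(a := Suc (x a))) (multinomial_pmf n k p)) g)"
    unfolding multinomial_pmf_Suc
  proof (rule pmf_expectation_bind)
    show "finite (set_pmf (map_pmf (\<lambda>x. x(a := Suc (x a))) (multinomial_pmf n k p)))" for a
      by (simp add: finite_set_multinomial_pmf[OF assms])
  qed (use set_categorical_pmf_subset[OF assms] in auto)
  also have "\<dots> = (\<Sum>a\<in>{1..k}. p a * (sample_step k p ^^ n) (\<lambda>x. g (x(a := Suc (x a)))) (\<lambda>_. 0))"
    by (intro sum.cong refl) (simp add: pmf_categorical[OF assms] Suc.IH)
  also have "\<dots> = (sample_step k p ^^ Suc n) g (\<lambda>_. 0)"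
    by (simp only: sample_steps_Suc_apply sample_steps_shift[where x = "\<lambda>_. 0"])
  finally show ?case .
qed (simp add: multinomial_pmf_def)

section \<open>Exponential moments by merging categories\<close>

text \<open>The binomial theorem for the commuting operators of drawing a category up to \<open>k\<close> and of drawing the
  category \<open>Suc k\<close>.\<close>

lemma sample_steps_Suc_categories:
  "(sample_step (Suc k) p ^^ n) F y
    = (\<Sum>x\<le>n. real (n choose x) * (p (Suc k) ^ x * (sample_step k p ^^ (n - x)) (\<lambda>z. F (z(Suc k := z (Suc k) + x))) y))"
proof (induction n arbitrary: F)
  case (Suc n)
  let ?q = "p (Suc k)"
  let ?\<tau> = "\<lambda>x F z. F (z(Suc k := z (Suc k) + x))"
  have split: "sample_step (Suc k) p F = (\<lambda>z. sample_step k p F z + ?q * ?\<tau> 1 F z)"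
    by (simp add: sample_step_def fun_eq_iff)
  have comm: "?\<tau> x (sample_step k p F) = sample_step k p (?\<tau> x F)" for x
    by (auto simp: sample_step_def fun_eq_iff fun_upd_twist intro!: sum.cong)
  have summand: "(sample_step k p ^^ (n - x)) (?\<tau> x (sample_step (Suc k) p F)) y
      = (sample_step k p ^^ (Suc n - x)) (?\<tau> x F) y + ?q * (sample_step k p ^^ (n - x)) (?\<tau> (Suc x) F) y" if "x \<le> n" for x
  proof -
    have "?\<tau> x (sample_step (Suc k) p F) = (\<lambda>z. sample_step k p (?\<tau> x F) z + ?q * ?\<tau> (Suc x) F z)"
      unfolding split comm[symmetric] by (simp add: fun_eq_iff)
    then show ?thesis
      using that by (simp add: sample_steps_add sample_steps_cmult Suc_diff_le funpow_swap1 del: fun_upd_apply)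
  qed
  have "(sample_step (Suc k) p ^^ Suc n) F y = (sample_step (Suc k) p ^^ n) (sample_step (Suc k) p F) y"
    by (simp only: sample_steps_Suc)
  also have "\<dots> = (\<Sum>x\<le>n. real (n choose x) * (?q ^ x * ((sample_step k p ^^ (Suc n - x)) (?\<tau> x F) y
        + ?q * (sample_step k p ^^ (n - x)) (?\<tau> (Suc x) F) y)))"
    unfolding Suc.IH by (intro sum.cong refl) (simp only: summand atMost_iff)
  also have "\<dots> = (\<Sum>x\<le>n. real (n choose x) * (?q ^ x * (sample_step k p ^^ (Suc n - x)) (?\<tau> x F) y
        + ?q ^ Suc x * (sample_step k p ^^ (Suc n - Suc x)) (?\<tau> (Suc x) F) y))"
    by (intro sum.cong refl) (simp add: algebra_simps del: fun_upd_apply)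
  also have "\<dots> = (\<Sum>x\<le>Suc n. real (Suc n choose x) * (?q ^ x * (sample_step k p ^^ (Suc n - x)) (?\<tau> x F) y))"
    by (rule sum_binomial_Suc[symmetric])
  finally show ?case .
qed (simp)

lemma sample_steps_untouched_coordinate:
  "(sample_step k p ^^ n) (\<lambda>z. g (z (Suc k)) * F z) y = g (y (Suc k)) * (sample_step k p ^^ n) F y"
  by (induction n arbitrary: y) (auto simp: sample_steps_Suc_apply sum_distrib_left simp del: funpow.simps(2) intro!: sum.cong)

text \<open>Induction over the categories, merging the last one into the others at the price of a factor \<open>2\<close>.\<close>

lemma sample_steps_prod_le:
  assumes "\<And>i. i \<in> {1..k} \<Longrightarrow> 0 < p i"
  shows "(sample_step k p ^^ n) (\<lambda>x. \<Prod>i=1..k. sqrt (real (x i) / p i) ^ x i) (\<lambda>_. 0)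
    \<le> 2 ^ k * sqrt ((\<Sum>i=1..k. p i) * real n) ^ n"
  using assms
proof (induction k arbitrary: n)
  case 0
  show ?case by (cases n) (auto simp: sample_steps_Suc_apply simp del: funpow.simps(2))
next
  case (Suc k)
  let ?q = "p (Suc k)" and ?r = "\<Sum>i=1..k. p i"
  let ?h = "\<lambda>x. \<Prod>i=1..k. sqrt (real (x i) / p i) ^ x i"
  let ?z = "\<lambda>_::nat. 0::nat"
  have q: "?q > 0" and r: "?r \<ge> 0" using Suc.prems by (auto intro!: sum_nonneg) (meson less_imp_le le_SucI)
  have "(sample_step (Suc k) p ^^ n) (\<lambda>x. \<Prod>i=1..Suc k. sqrt (real (x i) / p i) ^ x i) ?z
      = (\<Sum>x\<le>n. real (n choose x) * (?q ^ x * (sqrt (real x / ?q) ^ x * (sample_step k p ^^ (n - x)) ?h ?z)))"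
    unfolding sample_steps_Suc_categories
  proof (intro sum.cong refl arg_cong2[where f = "(*)"])
    fix x
    have "(\<lambda>z. \<Prod>i=1..Suc k. sqrt (real ((z(Suc k := z (Suc k) + x)) i) / p i) ^ (z(Suc k := z (Suc k) + x)) i)
       = (\<lambda>z. sqrt (real (z (Suc k) + x) / ?q) ^ (z (Suc k) + x) * ?h z)"
      by (auto simp: fun_eq_iff intro!: prod.cong)
    then show "(sample_step k p ^^ (n - x)) (\<lambda>z. \<Prod>i=1..Suc k. sqrt (real ((z(Suc k := z (Suc k) + x)) i) / p i)
          ^ (z(Suc k := z (Suc k) + x)) i) ?z
       = sqrt (real x / ?q) ^ x * (sample_step k p ^^ (n - x)) ?h ?z"
      by (simp only: sample_steps_untouched_coordinate[where g = "\<lambda>m. sqrt (real (m + x) / ?q) ^ (m + x)"]) simp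
  qed
  also have "\<dots> \<le> (\<Sum>x\<le>n. real (n choose x) * (?q ^ x * (sqrt (real x / ?q) ^ x * (2 ^ k * sqrt (?r * real (n - x)) ^ (n - x)))))"
    by (intro sum_mono mult_left_mono Suc.IH Suc.prems zero_le_power real_sqrt_ge_zero divide_nonneg_pos q less_imp_le[OF q]) auto
  also have "\<dots> = 2 ^ k * (\<Sum>x\<le>n. real (n choose x) * (sqrt (?r * real (n - x)) ^ (n - x) * sqrt (?q * real x) ^ x))"
    unfolding sum_distrib_left
  proof (intro sum.cong refl)
    fix x
    have "?q * sqrt (real x / ?q) = sqrt (?q * real x)"
      using q by (simp add: real_sqrt_divide real_sqrt_mult field_simps)
    then have "?q ^ x * sqrt (real x / ?q) ^ x = sqrt (?q * real x) ^ x"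
      by (simp flip: power_mult_distrib)
    then show "real (n choose x) * (?q ^ x * (sqrt (real x / ?q) ^ x * (2 ^ k * sqrt (?r * real (n - x)) ^ (n - x))))
       = 2 ^ k * (real (n choose x) * (sqrt (?r * real (n - x)) ^ (n - x) * sqrt (?q * real x) ^ x))"
      by (simp flip: mult.assoc)
  qed
  also have "(\<Sum>x\<le>n. real (n choose x) * (sqrt (?r * real (n - x)) ^ (n - x) * sqrt (?q * real x) ^ x))
      = (\<Sum>x\<le>n. real (n choose x) * (sqrt (?r * real x) ^ x * sqrt (?q * real (n - x)) ^ (n - x)))"
    by (rule sum.reindex_bij_witness[of _ "\<lambda>x. n - x" "\<lambda>x. n - x"]) (auto simp: binomial_symmetric[symmetric])
  also have "2 ^ k * \<dots> \<le> 2 ^ k * (2 * sqrt ((?r + ?q) * real n) ^ n)"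
    by (intro mult_left_mono binomial_sqrt_sum_le q r) auto
  finally show ?case by (simp add: add.commute)
qed

section \<open>Subadditivity of entropy\<close>

text \<open>Entropy in the sense of the entropy method, with \<open>p\<close> in the role of the underlying measure.\<close>

definition ent :: "'a set \<Rightarrow> ('a \<Rightarrow> real) \<Rightarrow> ('a \<Rightarrow> real) \<Rightarrow> real" where
  "ent A p f = (\<Sum>a\<in>A. p a * (f a * ln (f a))) - (\<Sum>a\<in>A. p a * f a) * ln (\<Sum>a\<in>A. p a * f a)"

lemma mult_ln_ge:
  fixes z v :: real
  assumes "z > 0" "v > 0"
  shows "z * ln v + z - v \<le> z * ln z"
proof -
  have "z * (ln v - ln z) \<le> z * (v / z - 1)"
    using assms ln_le_minus_one[of "v / z"] by (intro mult_left_mono) (auto simp: ln_div)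
  then show ?thesis using assms by (simp add: algebra_simps)
qed

text \<open>One half of the duality formula for entropy; equality holds for \<open>g = f\<close>. It presents entropy as a
  supremum of linear functionals, which is why entropy is convex.\<close>

lemma ent_ge_dual:
  assumes A: "finite A" "A \<noteq> {}" and p: "\<And>a. a \<in> A \<Longrightarrow> p a > 0"
    and f: "\<And>a. a \<in> A \<Longrightarrow> f a > 0" and g: "\<And>a. a \<in> A \<Longrightarrow> g a > 0"
  shows "(\<Sum>a\<in>A. p a * (f a * ln (g a / (\<Sum>b\<in>A. p b * g b)))) \<le> ent A p f"
proof -
  define Pf where "Pf = (\<Sum>a\<in>A. p a * f a)"
  define Pg where "Pg = (\<Sum>a\<in>A. p a * g a)"
  have pos: "Pf > 0" "Pg > 0" using A p f g by (auto simp: Pf_def Pg_def intro!: sum_pos)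
  have pw: "p a * (f a * ln (g a / Pg)) + p a * f a * ln Pf + p a * f a - Pf / Pg * (p a * g a)
      \<le> p a * (f a * ln (f a))" if "a \<in> A" for a
  proof -
    have *: "ln (g a / Pg * Pf) = ln (g a / Pg) + ln Pf"
      using pos g[OF that] by (intro ln_mult_pos) auto
    have "f a * ln (g a / Pg * Pf) + f a - g a / Pg * Pf \<le> f a * ln (f a)"
      using pos f[OF that] g[OF that] by (intro mult_ln_ge) auto
    then have "p a * (f a * (ln (g a / Pg) + ln Pf) + f a - g a / Pg * Pf) \<le> p a * (f a * ln (f a))"
      unfolding * using p[OF that] by (intro mult_left_mono) auto
    then show ?thesis by (simp add: algebra_simps)
  qed
  have "(\<Sum>a\<in>A. p a * (f a * ln (g a / Pg))) + Pf * ln Pf + Pf - Pf / Pg * Pg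
      = (\<Sum>a\<in>A. p a * (f a * ln (g a / Pg)) + p a * f a * ln Pf + p a * f a - Pf / Pg * (p a * g a))"
    unfolding sum.distrib sum_subtractf sum_distrib_left[symmetric] sum_distrib_right[symmetric]
    by (simp add: Pf_def Pg_def)
  also have "\<dots> \<le> (\<Sum>a\<in>A. p a * (f a * ln (f a)))"
    by (intro sum_mono pw)
  finally show ?thesis using pos unfolding ent_def Pf_def[symmetric] Pg_def[symmetric] by simp
qed

text \<open>Convexity of entropy: apply duality to each component, with the mixture as the test function.\<close>

lemma ent_mixture_le:
  assumes A: "finite A" "A \<noteq> {}" and p: "\<And>a. a \<in> A \<Longrightarrow> p a > 0"
    and B: "finite B" "B \<noteq> {}" and q: "\<And>b. b \<in> B \<Longrightarrow> q b > 0"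
    and f: "\<And>a b. a \<in> A \<Longrightarrow> b \<in> B \<Longrightarrow> f b a > 0"
  shows "ent A p (\<lambda>a. \<Sum>b\<in>B. q b * f b a) \<le> (\<Sum>b\<in>B. q b * ent A p (f b))"
proof -
  define G where "G = (\<lambda>a. \<Sum>b\<in>B. q b * f b a)"
  define PG where "PG = (\<Sum>a\<in>A. p a * G a)"
  have G: "G a > 0" if "a \<in> A" for a
    using that B q f by (auto simp: G_def intro!: sum_pos)
  have PG: "PG > 0" using A p G by (auto simp: PG_def intro!: sum_pos)
  have "ent A p G = (\<Sum>a\<in>A. p a * (G a * ln (G a)) - p a * G a * ln PG)"
    by (simp add: ent_def PG_def sum_subtractf sum_distrib_right)
  also have "\<dots> = (\<Sum>a\<in>A. p a * (G a * ln (G a / PG)))"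
  proof (intro sum.cong refl)
    fix a assume "a \<in> A"
    then have eq: "ln (G a / PG) = ln (G a) - ln PG" using G PG by (intro ln_divide_pos) auto
    show "p a * (G a * ln (G a)) - p a * G a * ln PG = p a * (G a * ln (G a / PG))"
      unfolding eq by (simp add: algebra_simps)
  qed
  also have "\<dots> = (\<Sum>a\<in>A. \<Sum>b\<in>B. q b * (p a * (f b a * ln (G a / PG))))"
  proof (intro sum.cong refl)
    fix a
    have "p a * (G a * c) = (\<Sum>b\<in>B. q b * (p a * (f b a * c)))" for c
      unfolding G_def sum_distrib_left sum_distrib_right by (intro sum.cong refl) simp
    then show "p a * (G a * ln (G a / PG)) = (\<Sum>b\<in>B. q b * (p a * (f b a * ln (G a / PG))))" .
  qed
  also have "\<dots> = (\<Sum>b\<in>B. q b * (\<Sum>a\<in>A. p a * (f b a * ln (G a / PG))))"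
    by (subst sum.swap) (simp add: sum_distrib_left)
  also have "\<dots> \<le> (\<Sum>b\<in>B. q b * ent A p (f b))"
  proof (intro sum_mono mult_left_mono)
    fix b assume b: "b \<in> B"
    show "(\<Sum>a\<in>A. p a * (f b a * ln (G a / PG))) \<le> ent A p (f b)"
      unfolding PG_def by (rule ent_ge_dual) (use A p f[OF _ b] G in auto)
    show "0 \<le> q b" using q[OF b] by simp
  qed
  finally show ?thesis by (simp add: G_def)
qed

definition psi :: "real \<Rightarrow> real" where
  "psi x = exp x - 1 - x"

text \<open>The other variational formula, \<open>ent f = inf\<^sub>v E (f ln (f / v) - f + v)\<close>, at \<open>v = exp u\<close>. Here \<open>u\<close> is free; it
  will be the value before the sample is added, so that only the increments of \<open>h\<close> appear.\<close>

lemma ent_exp_le: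
  assumes A: "finite A" and p: "\<And>a. a \<in> A \<Longrightarrow> p a > 0" "(\<Sum>a\<in>A. p a) = 1"
  shows "ent A p (\<lambda>a. exp (h a)) \<le> (\<Sum>a\<in>A. p a * (exp (h a) * psi (u - h a)))"
proof -
  define P where "P = (\<Sum>a\<in>A. p a * exp (h a))"
  have "A \<noteq> {}" using p(2) by auto
  then have P: "P > 0" using A p(1) by (auto simp: P_def intro!: sum_pos)
  have *: "exp (h a) * psi (u - h a) = exp u - exp (h a) + exp (h a) * h a - exp (h a) * u" for a
    by (simp add: psi_def exp_diff algebra_simps)
  have "(\<Sum>a\<in>A. p a * (exp (h a) * psi (u - h a)))
      = (\<Sum>a\<in>A. p a * exp u - p a * exp (h a) + p a * (exp (h a) * h a) - p a * exp (h a) * u)"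
    unfolding * by (intro sum.cong refl) (simp add: algebra_simps)
  also have "\<dots> = exp u - P + (\<Sum>a\<in>A. p a * (exp (h a) * h a)) - P * u"
    unfolding sum.distrib sum_subtractf sum_distrib_right[symmetric] p(2) P_def by simp
  finally show ?thesis
    unfolding ent_def P_def[symmetric] using mult_ln_ge[OF P, of "exp u"] by simp
qed

definition ent_step :: "nat \<Rightarrow> (nat \<Rightarrow> real) \<Rightarrow> ((nat \<Rightarrow> nat) \<Rightarrow> real) \<Rightarrow> (nat \<Rightarrow> nat) \<Rightarrow> real" where
  "ent_step k p F x = ent {1..k} p (\<lambda>a. F (x(a := Suc (x a))))"

lemma ent_step_eq:
  "ent_step k p F x = sample_step k p (\<lambda>y. F y * ln (F y)) x - sample_step k p F x * ln (sample_step k p F x)"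
  unfolding ent_step_def ent_def sample_step_def ..

lemma ent_step_step_le:
  assumes "k \<ge> 1" "\<And>i. i \<in> {1..k} \<Longrightarrow> 0 < p i" "\<And>x. F x > 0"
  shows "ent_step k p (sample_step k p F) x \<le> sample_step k p (ent_step k p F) x"
proof -
  have swap: "(x(a := Suc (x a)))(b := Suc ((x(a := Suc (x a))) b))
      = (x(b := Suc (x b)))(a := Suc ((x(b := Suc (x b))) a))" for a b
    by (auto simp: fun_eq_iff)
  have "ent_step k p (sample_step k p F) x
      = ent {1..k} p (\<lambda>a. \<Sum>b=1..k. p b * F ((x(b := Suc (x b)))(a := Suc ((x(b := Suc (x b))) a))))"
    unfolding ent_step_def sample_step_def swap ..
  also have "\<dots> \<le> (\<Sum>b=1..k. p b * ent {1..k} p (\<lambda>a. F ((x(b := Suc (x b)))(a := Suc ((x(b := Suc (x b))) a)))))"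
    using assms by (intro ent_mixture_le) auto
  also have "\<dots> = sample_step k p (ent_step k p F) x"
    unfolding ent_step_def sample_step_def ..
  finally show ?thesis .
qed

text \<open>Tensorization of entropy. The chain rule splits off the last sample; what remains is the entropy of
  the conditional expectation \<open>T F\<close>, whose one-sample entropy is at most the mean of that of \<open>F\<close> by
  convexity. As the samples are exchangeable, all \<open>Suc m\<close> of them contribute the same amount.\<close>

lemma entropy_subadditive:
  assumes k: "k \<ge> 1" and p: "\<And>i. i \<in> {1..k} \<Longrightarrow> 0 < p i" and F: "\<And>x. F x > 0"
  shows "(sample_step k p ^^ Suc m) (\<lambda>y. F y * ln (F y)) x - (sample_step k p ^^ Suc m) F x * ln ((sample_step k p ^^ Suc m) F x)
    \<le> real (Suc m) * (sample_step k p ^^ m) (ent_step k p F) x"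
  using F
proof (induction m arbitrary: F)
  case 0
  show ?case by (simp add: ent_step_eq)
next
  case (Suc m)
  let ?T = "sample_step k p"
  have pos: "?T F x > 0" for x
    using sample_steps_pos[OF k p, where F = F and n = 1 and x = x] Suc.prems by simp
  have "(?T ^^ Suc (Suc m)) (\<lambda>y. F y * ln (F y)) x - (?T ^^ Suc (Suc m)) F x * ln ((?T ^^ Suc (Suc m)) F x)
      = (?T ^^ Suc m) (\<lambda>x. ?T (\<lambda>y. F y * ln (F y)) x - ?T F x * ln (?T F x)) x
        + ((?T ^^ Suc m) (\<lambda>x. ?T F x * ln (?T F x)) x - (?T ^^ Suc m) (?T F) x * ln ((?T ^^ Suc m) (?T F) x))"
    unfolding sample_steps_diff sample_steps_Suc[of "Suc m"] by simp
  moreover have "(?T ^^ Suc m) (\<lambda>x. ?T (\<lambda>y. F y * ln (F y)) x - ?T F x * ln (?T F x)) x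
      = (?T ^^ Suc m) (ent_step k p F) x"
    unfolding ent_step_eq[abs_def] ..
  moreover have "(?T ^^ Suc m) (\<lambda>x. ?T F x * ln (?T F x)) x - (?T ^^ Suc m) (?T F) x * ln ((?T ^^ Suc m) (?T F) x)
      \<le> real (Suc m) * (?T ^^ m) (ent_step k p (?T F)) x"
    by (rule Suc.IH) (rule pos)
  moreover have "(?T ^^ m) (ent_step k p (?T F)) x \<le> (?T ^^ m) (?T (ent_step k p F)) x"
  proof (rule sample_steps_mono)
    show "0 \<le> p i" if "i \<in> {1..k}" for i using p[OF that] by simp
    show "ent_step k p (?T F) y \<le> ?T (ent_step k p F) y" for y
      by (rule ent_step_step_le[OF k p Suc.prems])
  qed
  then have "real (Suc m) * (?T ^^ m) (ent_step k p (?T F)) x \<le> real (Suc m) * (?T ^^ Suc m) (ent_step k p F) x"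
    unfolding sample_steps_Suc by (rule mult_left_mono) simp
  moreover have "real (Suc (Suc m)) * (?T ^^ Suc m) (ent_step k p F) x
      = (?T ^^ Suc m) (ent_step k p F) x + real (Suc m) * (?T ^^ Suc m) (ent_step k p F) x"
    by (simp add: algebra_simps del: funpow.simps(2))
  ultimately show ?case by linarith
qed

text \<open>Summing a function of the category of a sample over all samples weights it with the counts. For
  \<open>x = 0\<close> this converts \<open>n\<close> times the contribution of the last sample into an expectation of a sum over
  categories.\<close>

lemma sample_steps_sum_counts:
  fixes R :: "nat \<Rightarrow> (nat \<Rightarrow> nat) \<Rightarrow> real"
  shows "(sample_step k p ^^ n) (\<lambda>y. \<Sum>a=1..k. real (y a) * R a y) x
    = real n * (sample_step k p ^^ (n - 1)) (\<lambda>y. \<Sum>a=1..k. p a * R a (y(a := Suc (y a)))) x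
      + (\<Sum>a=1..k. real (x a) * (sample_step k p ^^ n) (R a) x)"
proof (induction n arbitrary: R)
  case (Suc n)
  let ?T = "sample_step k p"
  let ?S = "\<lambda>(R :: nat \<Rightarrow> (nat \<Rightarrow> nat) \<Rightarrow> real) y. \<Sum>a=1..k. p a * R a (y(a := Suc (y a)))"
  have T: "?T (\<lambda>y. \<Sum>a=1..k. real (y a) * R a y) = (\<lambda>y. (\<Sum>a=1..k. real (y a) * ?T (R a) y) + ?S R y)"
  proof
    fix y :: "nat \<Rightarrow> nat"
    have "?T (\<lambda>y. \<Sum>a=1..k. real (y a) * R a y) y
        = (\<Sum>b=1..k. p b * (\<Sum>a=1..k. real ((y(b := Suc (y b))) a) * R a (y(b := Suc (y b)))))"
      by (rule sample_step_def)
    also have "\<dots> = (\<Sum>b=1..k. p b * ((\<Sum>a=1..k. real (y a) * R a (y(b := Suc (y b)))) + R b (y(b := Suc (y b)))))"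
    proof (intro sum.cong refl arg_cong2[where f = "(*)"])
      fix b assume b: "b \<in> {1..k}"
      have "(\<Sum>a=1..k. real ((y(b := Suc (y b))) a) * R a (y(b := Suc (y b))))
          = (\<Sum>a=1..k. real (y a) * R a (y(b := Suc (y b))) + (if a = b then R b (y(b := Suc (y b))) else 0))"
        by (intro sum.cong refl) (auto simp: algebra_simps)
      then show "(\<Sum>a=1..k. real ((y(b := Suc (y b))) a) * R a (y(b := Suc (y b))))
          = (\<Sum>a=1..k. real (y a) * R a (y(b := Suc (y b)))) + R b (y(b := Suc (y b)))"
        using b by (simp add: sum.distrib)
    qed
    also have "\<dots> = (\<Sum>b=1..k. \<Sum>a=1..k. real (y a) * (p b * R a (y(b := Suc (y b))))) + ?S R y"
      by (simp add: algebra_simps sum.distrib sum_distrib_left)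
    also have "(\<Sum>b=1..k. \<Sum>a=1..k. real (y a) * (p b * R a (y(b := Suc (y b))))) = (\<Sum>a=1..k. real (y a) * ?T (R a) y)"
      by (subst sum.swap) (simp add: sample_step_def sum_distrib_left)
    finally show "?T (\<lambda>y. \<Sum>a=1..k. real (y a) * R a y) y = (\<Sum>a=1..k. real (y a) * ?T (R a) y) + ?S R y" .
  qed
  have S: "?S (\<lambda>a. ?T (R a)) = ?T (?S R)"
  proof
    fix y :: "nat \<Rightarrow> nat"
    have swap: "(y(a := Suc (y a)))(b := Suc ((y(a := Suc (y a))) b))
        = (y(b := Suc (y b)))(a := Suc ((y(b := Suc (y b))) a))" for a b
      by (auto simp: fun_eq_iff)
    have "?S (\<lambda>a. ?T (R a)) y = (\<Sum>a=1..k. \<Sum>b=1..k. p a * (p b * R a ((y(b := Suc (y b)))(a := Suc ((y(b := Suc (y b))) a)))))"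
      unfolding sample_step_def sum_distrib_left swap ..
    also have "\<dots> = (\<Sum>b=1..k. \<Sum>a=1..k. p b * (p a * R a ((y(b := Suc (y b)))(a := Suc ((y(b := Suc (y b))) a)))))"
      by (subst sum.swap) (simp only: mult.left_commute)
    also have "\<dots> = ?T (?S R) y"
      unfolding sample_step_def sum_distrib_left ..
    finally show "?S (\<lambda>a. ?T (R a)) y = ?T (?S R) y" .
  qed
  have "(?T ^^ Suc n) (\<lambda>y. \<Sum>a=1..k. real (y a) * R a y) x
      = (?T ^^ n) (\<lambda>y. \<Sum>a=1..k. real (y a) * ?T (R a) y) x + (?T ^^ n) (?S R) x"
    unfolding sample_steps_Suc T sample_steps_add ..
  also have "\<dots> = real n * (?T ^^ (n - 1)) (?T (?S R)) x + (\<Sum>a=1..k. real (x a) * (?T ^^ Suc n) (R a) x) + (?T ^^ n) (?S R) x"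
    unfolding Suc.IH S sample_steps_Suc ..
  also have "real n * (?T ^^ (n - 1)) (?T (?S R)) x = real n * (?T ^^ n) (?S R) x"
    by (cases n) (simp_all only: sample_steps_Suc diff_Suc_1 of_nat_0 mult_zero_left)
  finally show ?case by (simp add: algebra_simps del: funpow.simps(2) fun_upd_apply)
qed simp

section \<open>Increments of the Poisson deviance\<close>

lemma psi_nonneg: "psi x \<ge> 0"
  using exp_ge_add_one_self[of x] unfolding psi_def by linarith

lemma psi_ge_square:
  assumes "m \<ge> 0"
  shows "m\<^sup>2 / 2 \<le> psi m"
  using exp_lower_Taylor_quadratic[OF assms] by (simp add: psi_def)

lemma psi_neg_le:
  assumes "a \<ge> 0"
  shows "psi (- a) \<le> a\<^sup>2 / 2"
proof -
  have "(\<lambda>a. a\<^sup>2 / 2 - psi (- a)) 0 \<le> (\<lambda>a. a\<^sup>2 / 2 - psi (- a)) a"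
  proof (rule DERIV_nonneg_imp_nondecreasing[OF assms])
    fix x :: real
    have "((\<lambda>a. a\<^sup>2 / 2 - psi (- a)) has_real_derivative x + exp (- x) - 1) (at x)"
      unfolding psi_def by (auto intro!: derivative_eq_intros)
    moreover have "x + exp (- x) - 1 \<ge> 0" using exp_ge_add_one_self[of "- x"] by simp
    ultimately show "\<exists>y. ((\<lambda>a. a\<^sup>2 / 2 - psi (- a)) has_real_derivative y) (at x) \<and> 0 \<le> y" by blast
  qed
  then show ?thesis by (simp add: psi_def)
qed

lemma psi_le_square:
  assumes "0 \<le> a" "a \<le> 1"
  shows "psi a \<le> a\<^sup>2"
  using exp_bound[OF assms] by (simp add: psi_def)

text \<open>The factor \<open>1 + l\<close> cannot be avoided, as \<open>psi (- l)\<close> grows only linearly; it is what produces the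
  logarithm of \<open>k / \<alpha>\<close>.\<close>

lemma square_le_psi_neg:
  assumes "l \<ge> 0"
  shows "l\<^sup>2 \<le> 2 * (1 + l) * psi (- l)"
proof -
  have "(\<lambda>l. 2 * (1 + l) * psi (- l) - l\<^sup>2) 0 \<le> (\<lambda>l. 2 * (1 + l) * psi (- l) - l\<^sup>2) l"
  proof (rule DERIV_nonneg_imp_nondecreasing[OF assms])
    fix x :: real assume x: "0 \<le> x"
    have "((\<lambda>l. 2 * (1 + l) * psi (- l) - l\<^sup>2) has_real_derivative 2 * x * (1 - exp (- x))) (at x)"
      unfolding psi_def by (auto intro!: derivative_eq_intros simp: algebra_simps)
    moreover have "2 * x * (1 - exp (- x)) \<ge> 0" using x by simp
    ultimately show "\<exists>y. ((\<lambda>l. 2 * (1 + l) * psi (- l) - l\<^sup>2) has_real_derivative y) (at x) \<and> 0 \<le> y" by blast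
  qed
  then show ?thesis by (simp add: psi_def)
qed

lemma psi_scale_le:
  assumes \<tau>: "0 \<le> \<tau>" "\<tau> \<le> 1" and "y \<ge> 0"
  shows "psi (\<tau> * y) \<le> \<tau>\<^sup>2 * psi y"
proof -
  have "(\<lambda>y. \<tau>\<^sup>2 * psi y - psi (\<tau> * y)) 0 \<le> (\<lambda>y. \<tau>\<^sup>2 * psi y - psi (\<tau> * y)) y"
  proof (rule DERIV_nonneg_imp_nondecreasing[OF \<open>y \<ge> 0\<close>])
    fix x :: real
    have "((\<lambda>y. \<tau>\<^sup>2 * psi y - psi (\<tau> * y)) has_real_derivative \<tau> * ((1 - \<tau>) * exp 0 + \<tau> * exp x - exp (\<tau> * x))) (at x)"
      unfolding psi_def by (auto intro!: derivative_eq_intros simp: algebra_simps power2_eq_square)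
    moreover have "exp (\<tau> * x) \<le> (1 - \<tau>) * exp 0 + \<tau> * exp x"
      using convex_onD[OF exp_convex, of \<tau> 0 x] \<tau> by simp
    then have "\<tau> * ((1 - \<tau>) * exp 0 + \<tau> * exp x - exp (\<tau> * x)) \<ge> 0"
      using \<tau> by (intro mult_nonneg_nonneg) auto
    ultimately show "\<exists>z. ((\<lambda>y. \<tau>\<^sup>2 * psi y - psi (\<tau> * y)) has_real_derivative z) (at x) \<and> 0 \<le> z" by blast
  qed
  then show ?thesis by (simp add: psi_def)
qed

text \<open>Twice the relative entropy of the Poisson law of mean \<open>x\<close> from that of mean \<open>l\<close>.\<close>

definition poisson_deviance :: "real \<Rightarrow> nat \<Rightarrow> real" where
  "poisson_deviance l x = 2 * (real x * ln (real x / l) - real x + l)"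

lemma poisson_deviance_eq_psi:
  assumes "l > 0" "x > 0"
  shows "poisson_deviance l x = 2 * (real x * psi (- ln (real x / l)))"
  using assms by (simp add: poisson_deviance_def psi_def exp_minus field_simps)

lemma poisson_deviance_nonneg:
  assumes "l > 0"
  shows "poisson_deviance l x \<ge> 0"
proof (cases "x = 0")
  case False
  then show ?thesis using assms by (simp add: poisson_deviance_eq_psi psi_nonneg)
qed (use assms in \<open>simp add: poisson_deviance_def\<close>)

text \<open>The increment is the derivative \<open>2 ln (x / l)\<close> up to a discretization error that decays like \<open>1 / x\<close>.\<close>

lemma poisson_deviance_increment:
  assumes "l > 0" "x > 0"
  obtains \<theta> where "0 \<le> \<theta>" "real x * \<theta> \<le> 1" "poisson_deviance l x - poisson_deviance l (x - 1) = 2 * (ln (real x / l) - \<theta>)"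
proof
  let ?\<theta> = "ln (real x / l) - (poisson_deviance l x - poisson_deviance l (x - 1)) / 2"
  show "poisson_deviance l x - poisson_deviance l (x - 1) = 2 * (ln (real x / l) - ?\<theta>)" by simp
  show "0 \<le> ?\<theta>" "real x * ?\<theta> \<le> 1"
  proof -
    define y where "y = real x - 1"
    have y: "real (x - 1) = y" using assms by (simp add: y_def of_nat_diff)
    have "0 \<le> ?\<theta> \<and> (y + 1) * ?\<theta> \<le> 1"
    proof (cases "x = 1")
      case True
      then show ?thesis using assms by (simp add: poisson_deviance_def y_def field_simps)
    next
      case False
      then have y0: "y > 0" using assms by (simp add: y_def)
      have \<theta>: "?\<theta> = 1 - y * ln ((y + 1) / y)"
        using assms y0 unfolding poisson_deviance_def y
        by (simp add: y_def ln_div field_simps)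
      have "ln ((y + 1) / y) \<le> (y + 1) / y - 1" using y0 by (intro ln_le_minus_one) auto
      then have "y * ln ((y + 1) / y) \<le> 1" using y0 by (simp add: field_simps)
      moreover have "- ln ((y + 1) / y) \<le> y / (y + 1) - 1"
        using y0 ln_le_minus_one[of "y / (y + 1)"] by (simp add: ln_div)
      then have "(y + 1) * ln ((y + 1) / y) \<ge> 1" using y0 by (simp add: field_simps)
      then have "y * ((y + 1) * ln ((y + 1) / y)) \<ge> y * 1" using y0 by (intro mult_left_mono) auto
      ultimately show ?thesis unfolding \<theta> by (simp add: algebra_simps)
    qed
    then show "0 \<le> ?\<theta>" "real x * ?\<theta> \<le> 1" by (auto simp: y_def)
  qed
qed

text \<open>The local estimate behind the entropy method. With \<open>s = ln (x / l)\<close> and \<open>d\<close> half the increment, so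
  that \<open>s - 1 / x \<le> d \<le> s\<close>, the deviance equals \<open>2 x psi (- s)\<close> and the claim compares \<open>psi (- 2 t d)\<close> with
  \<open>psi (- s)\<close>. If the argument of \<open>psi\<close> is at most \<open>1\<close>, then \<open>psi\<close> is at most a square there and \<open>x d\<^sup>2\<close> is
  compared with the deviance. The argument exceeds \<open>1\<close> only for \<open>t > 0\<close> and counts far below \<open>l\<close>. No bound
  on \<open>l / x\<close> is available in that case, but \<open>psi (2 t y) \<le> (2 t)\<^sup>2 psi y\<close> reduces it to \<open>psi (- d)\<close>, which is
  at most a multiple of \<open>psi (- s) + 1 / x\<close>.\<close>

lemma count_times_psi_increment_le:
  assumes "l > 0" "x > 0" and L: "L \<ge> 1" "ln (real x / l) \<le> L" and t: "\<bar>t\<bar> \<le> 1 / (8 * L)"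
  shows "real x * psi (- (t * (poisson_deviance l x - poisson_deviance l (x - 1)))) \<le> 16 * t\<^sup>2 * L * (poisson_deviance l x + 1)"
proof -
  define s where "s = ln (real x / l)"
  obtain \<theta> where \<theta>: "0 \<le> \<theta>" "real x * \<theta> \<le> 1" "poisson_deviance l x - poisson_deviance l (x - 1) = 2 * (s - \<theta>)"
    using poisson_deviance_increment[OF assms(1,2)] unfolding s_def by metis
  define d where "d = s - \<theta>"
  have x1: "real x \<ge> 1" using assms by simp
  have poisson_deviance: "poisson_deviance l x = 2 * (real x * psi (- s))" unfolding s_def by (rule poisson_deviance_eq_psi[OF assms(1,2)])
  have phi0: "poisson_deviance l x \<ge> 0" by (rule poisson_deviance_nonneg[OF assms(1)])
  have \<theta>1: "\<theta> \<le> 1" using \<theta> mult_right_mono[OF x1, of \<theta>] by simp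
  have x\<theta>2: "real x * \<theta>\<^sup>2 \<le> 1"
    using mult_mono[OF \<theta>(2) \<theta>1] \<theta> by (simp add: power2_eq_square)
  have t8: "\<bar>t\<bar> \<le> 1 / 8" "\<bar>t\<bar> * L \<le> 1 / 8"
  proof -
    show "\<bar>t\<bar> * L \<le> 1 / 8" using t L by (simp add: field_simps)
    moreover have "\<bar>t\<bar> * 1 \<le> \<bar>t\<bar> * L" using L by (intro mult_left_mono) auto
    ultimately show "\<bar>t\<bar> \<le> 1 / 8" by simp
  qed
  have xs2: "real x * s\<^sup>2 \<le> 2 * L * poisson_deviance l x"
  proof (cases "s \<ge> 0")
    case True
    have "s\<^sup>2 \<le> 2 * (1 + s) * psi (- s)" using True by (rule square_le_psi_neg)
    also have "\<dots> \<le> 2 * (2 * L) * psi (- s)"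
      using L psi_nonneg unfolding s_def by (intro mult_right_mono) auto
    finally have "real x * s\<^sup>2 \<le> real x * (2 * (2 * L) * psi (- s))" by (intro mult_left_mono) auto
    then show ?thesis by (simp add: poisson_deviance algebra_simps)
  next
    case False
    have "s\<^sup>2 \<le> 2 * psi (- s)" using psi_ge_square[of "- s"] False by simp
    then have "real x * s\<^sup>2 \<le> real x * (2 * psi (- s))" by (intro mult_left_mono) auto
    also have "\<dots> = 1 * poisson_deviance l x" by (simp add: poisson_deviance)
    also have "\<dots> \<le> 2 * L * poisson_deviance l x" using phi0 L by (intro mult_right_mono) auto
    finally show ?thesis .
  qed
  have xd2: "real x * d\<^sup>2 \<le> 4 * L * (poisson_deviance l x + 1)"
  proof -
    have "d\<^sup>2 \<le> 2 * s\<^sup>2 + 2 * \<theta>\<^sup>2"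
      using zero_le_power2[of "s + \<theta>"] unfolding d_def by (simp add: power2_eq_square algebra_simps)
    then have "real x * d\<^sup>2 \<le> real x * (2 * s\<^sup>2 + 2 * \<theta>\<^sup>2)" by (intro mult_left_mono) auto
    also have "\<dots> = 2 * (real x * s\<^sup>2) + 2 * (real x * \<theta>\<^sup>2)" by (simp add: algebra_simps)
    also have "\<dots> \<le> 4 * (L * poisson_deviance l x) + 2" using xs2 x\<theta>2 by simp
    also have "\<dots> \<le> 4 * L * (poisson_deviance l x + 1)" using L by (simp add: algebra_simps)
    finally show ?thesis .
  qed
  have by_square: ?thesis if "psi (- (t * (2 * d))) \<le> (t * (2 * d))\<^sup>2"
  proof -
    have "real x * psi (- (t * (2 * d))) \<le> real x * (t * (2 * d))\<^sup>2"
      using that by (intro mult_left_mono) auto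
    also have "\<dots> = 4 * t\<^sup>2 * (real x * d\<^sup>2)" by (simp add: power2_eq_square algebra_simps)
    also have "\<dots> \<le> 4 * t\<^sup>2 * (4 * L * (poisson_deviance l x + 1))" using xd2 by (intro mult_left_mono) auto
    finally show ?thesis unfolding \<theta>(3) d_def by (simp add: algebra_simps)
  qed
  \<comment> \<open>In the first two cases the argument of \<open>psi\<close> is at most \<open>1\<close>.\<close>
  consider "t * d \<ge> 0" | "t < 0" "d > 0" | "t > 0" "d < 0"
    by (metis linorder_not_less mult_nonneg_nonneg mult_nonpos_nonpos order_less_imp_le)
  then show ?thesis
  proof cases
    case 1
    then have "psi (- (t * (2 * d))) \<le> (t * (2 * d))\<^sup>2 / 2" by (intro psi_neg_le) (simp add: algebra_simps)
    then show ?thesis using zero_le_power2[of "t * (2 * d)"] by (intro by_square) linarith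
  next
    case 2
    have "d \<le> L" using \<theta>(1) L(2) by (simp add: d_def s_def)
    then have "\<bar>t\<bar> * d \<le> \<bar>t\<bar> * L" by (intro mult_left_mono) auto
    moreover have "\<bar>t\<bar> = - t" using 2 by simp
    ultimately have "- (t * (2 * d)) \<le> 1" using t8(2) by (simp only:)
    moreover have "0 \<le> - (t * (2 * d))" using 2 by (simp add: mult_nonpos_nonneg)
    ultimately have "psi (- (t * (2 * d))) \<le> (- (t * (2 * d)))\<^sup>2" by (intro psi_le_square)
    then show ?thesis by (intro by_square) simp
  next
    case 3
    have "real x * psi (- d) \<le> 3 * (poisson_deviance l x + 1)"
    proof (cases "s \<ge> 0")
      case True
      have "psi (- d) \<le> (- d)\<^sup>2" using 3 True \<theta>1 by (intro psi_le_square) (auto simp: d_def)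
      also have "\<dots> \<le> \<theta>\<^sup>2" using 3 True by (intro power_mono) (auto simp: d_def)
      finally have "real x * psi (- d) \<le> real x * \<theta>\<^sup>2" by (intro mult_left_mono) auto
      also have "\<dots> \<le> 1" by (rule x\<theta>2)
      finally show ?thesis using phi0 by simp
    next
      case False
      define m where "m = - s"
      have m: "m > 0" using False by (simp add: m_def)
      have e: "exp \<theta> \<le> 1 + \<theta> + \<theta>\<^sup>2" using exp_bound \<theta> \<theta>1 by simp
      have "\<theta>\<^sup>2 \<le> \<theta>" using \<theta>(1) \<theta>1 by (simp add: power2_eq_square mult_left_le)
      then have e3: "exp \<theta> \<le> 3" "\<theta> + \<theta>\<^sup>2 \<le> 2 * \<theta>" using e \<theta>1 by auto
      have "psi (- d) = exp \<theta> * psi m + (exp \<theta> - 1) * (1 + m) - \<theta>"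
        by (simp add: psi_def d_def m_def exp_add exp_diff exp_minus divide_inverse algebra_simps)
      also have "\<dots> \<le> 3 * psi m + (\<theta> + \<theta>\<^sup>2) * (1 + m) - \<theta>"
        using e e3 m psi_nonneg by (intro diff_mono add_mono mult_right_mono) auto
      also have "\<dots> = 3 * psi m + \<theta>\<^sup>2 + (\<theta> + \<theta>\<^sup>2) * m" by (simp add: algebra_simps)
      also have "\<dots> \<le> 3 * psi m + \<theta>\<^sup>2 + (2 * \<theta>) * m"
        using e3 m by (intro add_left_mono mult_right_mono) auto
      finally have "real x * psi (- d) \<le> real x * (3 * psi m + \<theta>\<^sup>2 + (2 * \<theta>) * m)"
        by (intro mult_left_mono) auto
      also have "\<dots> = 3 / 2 * poisson_deviance l x + real x * \<theta>\<^sup>2 + (real x * \<theta>) * (2 * m)"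
        by (simp add: poisson_deviance m_def algebra_simps)
      also have "\<dots> \<le> 3 / 2 * poisson_deviance l x + 1 + 1 * (2 * m)"
        using x\<theta>2 \<theta> m phi0 by (intro add_mono mult_right_mono) auto
      also have "m \<le> 1 + poisson_deviance l x / 2"
      proof -
        have "m \<le> 1 + m\<^sup>2 / 2" using zero_le_power2[of "m - 1"] by (simp add: power2_eq_square algebra_simps)
        also have "\<dots> \<le> 1 + psi m" using psi_ge_square[of m] m by simp
        also have "\<dots> \<le> 1 + poisson_deviance l x / 2" using mult_right_mono[OF x1 psi_nonneg[of m]] by (simp add: poisson_deviance m_def)
        finally show ?thesis .
      qed
      finally show ?thesis using phi0 by simp
    qed
    moreover have "psi (- (t * (2 * d))) \<le> (2 * t)\<^sup>2 * psi (- d)"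
      using psi_scale_le[of "2 * t" "- d"] 3 t8 by (simp add: mult_ac)
    then have "real x * psi (- (t * (2 * d))) \<le> real x * ((2 * t)\<^sup>2 * psi (- d))"
      by (intro mult_left_mono) auto
    then have "real x * psi (- (t * (2 * d))) \<le> 4 * t\<^sup>2 * (real x * psi (- d))"
      by (simp add: power2_eq_square algebra_simps)
    ultimately have "real x * psi (- (t * (2 * d))) \<le> 4 * t\<^sup>2 * (3 * (poisson_deviance l x + 1))"
      by (smt (verit) mult_left_mono zero_le_power2)
    also have "\<dots> \<le> 16 * t\<^sup>2 * (1 * (poisson_deviance l x + 1))"
      using phi0 mult_nonneg_nonneg[OF zero_le_power2[of t], of "poisson_deviance l x + 1"] by (simp add: algebra_simps)
    also have "\<dots> \<le> 16 * t\<^sup>2 * (L * (poisson_deviance l x + 1))"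
      using L phi0 by (intro mult_left_mono mult_right_mono) auto
    finally show ?thesis unfolding \<theta>(3) d_def by (simp add: algebra_simps)
  qed
qed

section \<open>Herbst's argument\<close>

text \<open>The hypothesis says that \<open>K t / t - c t\<close> has nonpositive derivative, and the limit of this function at
  \<open>0\<close> is \<open>K' 0\<close>.\<close>

lemma herbst_argument:
  fixes K K' :: "real \<Rightarrow> real"
  assumes deriv: "\<And>t. (K has_real_derivative K' t) (at t)" and "K 0 = 0"
    and ineq: "\<And>t. 0 < t \<Longrightarrow> t \<le> r \<Longrightarrow> t * K' t - K t \<le> c * t\<^sup>2"
    and t: "0 \<le> t" "t \<le> r"
  shows "K t \<le> K' 0 * t + c * t\<^sup>2"
proof (cases "t = 0")
  case False
  then have "t > 0" using t by simp
  define G where "G = (\<lambda>s. K s / s - c * s)"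
  have mono: "G t \<le> G s" if "0 < s" "s \<le> t" for s
  proof (rule DERIV_nonpos_imp_nonincreasing[OF \<open>s \<le> t\<close>])
    fix x assume x: "s \<le> x" "x \<le> t"
    then have x0: "x > 0" using that by simp
    have "(G has_real_derivative (K' x * x - K x) / (x * x) - c) (at x)"
      unfolding G_def using x0 by (auto intro!: derivative_eq_intros deriv simp: field_simps)
    moreover have "(K' x * x - K x) / (x * x) \<le> c"
      using ineq[of x] x x0 t by (simp add: field_simps power2_eq_square)
    ultimately show "\<exists>y. (G has_real_derivative y) (at x) \<and> y \<le> 0" by (meson diff_le_0_iff_le)
  qed
  have "((\<lambda>h. (K (0 + h) - K 0) / h) \<longlongrightarrow> K' 0) (at 0)"
    using deriv[of 0] by (simp only: DERIV_def)
  then have "((\<lambda>s. K s / s) \<longlongrightarrow> K' 0) (at_right 0)"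
    using \<open>K 0 = 0\<close> by (simp add: filterlim_at_split)
  moreover have "((\<lambda>s. c * s) \<longlongrightarrow> c * 0) (at_right 0)"
    by (intro tendsto_intros)
  ultimately have "(G \<longlongrightarrow> K' 0 - c * 0) (at_right 0)"
    unfolding G_def by (rule tendsto_diff)
  then have "G t \<le> K' 0 - c * 0"
  proof (rule tendsto_lowerbound)
    show "\<forall>\<^sub>F s in at_right 0. G t \<le> G s"
      using eventually_at_right_real[OF \<open>t > 0\<close>] by eventually_elim (auto intro: mono)
  qed simp
  then show ?thesis
    using \<open>t > 0\<close> by (simp add: G_def field_simps power2_eq_square)
qed (use assms in simp)

section \<open>The moment generating function of the likelihood ratio statistic\<close>

locale multinomial_sampling =
  fixes n k :: nat and p :: "nat \<Rightarrow> real"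
  assumes n_pos: "n \<ge> 1" and k_pos: "k \<ge> 1"
    and p_pos: "i \<in> {1..k} \<Longrightarrow> 0 < p i"
    and p_sum: "(\<Sum>i=1..k. p i) = 1"
begin

definition expect :: "((nat \<Rightarrow> nat) \<Rightarrow> real) \<Rightarrow> real" where
  "expect g = (sample_step k p ^^ n) g (\<lambda>_. 0)"

text \<open>On states whose counts add up to \<open>n\<close> this is the statistic \<open>Z_stat\<close>. Unlike \<open>Z_stat\<close>, its summands are
  nonnegative.\<close>

definition deviance :: "(nat \<Rightarrow> nat) \<Rightarrow> real" where
  "deviance x = (\<Sum>i=1..k. poisson_deviance (real n * p i) (x i))"

definition mgf :: "real \<Rightarrow> real" where
  "mgf t = expect (\<lambda>x. exp (t * deviance x))"

definition mgf' :: "real \<Rightarrow> real" where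
  "mgf' t = expect (\<lambda>x. deviance x * exp (t * deviance x))"

lemma expect_mono:
  assumes "\<And>x. (\<Sum>i=1..k. x i) = n \<Longrightarrow> f x \<le> g x"
  shows "expect f \<le> expect g"
  unfolding expect_def using assms p_pos by (intro sample_steps_mono) (auto intro: less_imp_le)

lemma expect_add: "expect (\<lambda>x. f x + g x) = expect f + expect g"
  unfolding expect_def sample_steps_add ..

lemma expect_cmult: "expect (\<lambda>x. c * f x) = c * expect f"
  unfolding expect_def sample_steps_cmult ..

lemma expect_const: "expect (\<lambda>_. c) = c"
  unfolding expect_def sample_steps_const[OF p_sum] ..

lemma rate_pos: "i \<in> {1..k} \<Longrightarrow> real n * p i > 0"
  using n_pos p_pos by simp

lemma deviance_nonneg: "deviance x \<ge> 0"
  unfolding deviance_def using rate_pos by (intro sum_nonneg poisson_deviance_nonneg)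

lemma mgf_pos: "mgf t > 0"
  unfolding mgf_def expect_def using k_pos p_pos by (intro sample_steps_pos) auto

lemma mgf_0: "mgf 0 = 1"
  by (simp add: mgf_def expect_const)

lemma mgf_DERIV: "(mgf has_real_derivative mgf' t) (at t)"
  unfolding mgf_def[abs_def] mgf'_def expect_def
  by (intro sample_steps_DERIV) (auto intro!: derivative_eq_intros)

lemma mgf_mono: "t \<le> u \<Longrightarrow> mgf t \<le> mgf u"
  unfolding mgf_def by (intro expect_mono) (simp add: mult_right_mono deviance_nonneg)

lemma mean_nonneg: "mgf' 0 \<ge> 0"
  using expect_mono[of "\<lambda>_. 0" deviance] by (simp add: mgf'_def expect_const deviance_nonneg)

text \<open>The weight \<open>exp (deviance / 4)\<close> is, up to a factor \<open>sqrt n ^ n\<close>, the product bounded by merging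
  categories.\<close>

lemma mgf_quarter_le: "mgf (1 / 4) \<le> 2 ^ k"
proof -
  let ?h = "\<lambda>x. \<Prod>i=1..k. sqrt (real (x i) / p i) ^ x i"
  have "mgf (1 / 4) \<le> expect (\<lambda>x. (1 / sqrt (real n) ^ n) * ?h x)"
    unfolding mgf_def
  proof (rule expect_mono)
    fix x assume x: "(\<Sum>i=1..k. x i) = n"
    \<comment> \<open>Summed over \<open>i\<close>, the exponents \<open>(n p\<^sub>i - x\<^sub>i) / 2\<close> cancel.\<close>
    have fac: "exp (poisson_deviance (real n * p i) (x i) / 4) = exp ((real n * p i - real (x i)) / 2)
        * (sqrt (real (x i) / p i) ^ x i * (1 / sqrt (real n)) ^ x i)" if i: "i \<in> {1..k}" for i
    proof -
      have sq: "exp (real (x i) * ln (real (x i) / (real n * p i)) / 2) = sqrt (real (x i) / (real n * p i)) ^ x i"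
      proof (cases "x i = 0")
        case False
        then have "real (x i) / (real n * p i) > 0" using rate_pos[OF i] by simp
        then have "sqrt (real (x i) / (real n * p i)) = exp (ln (real (x i) / (real n * p i)) / 2)"
          by (simp add: ln_sqrt[symmetric])
        then show ?thesis by (simp flip: exp_of_nat_mult)
      qed simp
      have "poisson_deviance (real n * p i) (x i) / 4 = (real n * p i - real (x i)) / 2
          + real (x i) * ln (real (x i) / (real n * p i)) / 2"
        by (simp add: poisson_deviance_def field_simps)
      then have "exp (poisson_deviance (real n * p i) (x i) / 4) = exp ((real n * p i - real (x i)) / 2)
          * sqrt (real (x i) / (real n * p i)) ^ x i"
        by (simp only: exp_add sq)
      also have "sqrt (real (x i) / (real n * p i)) = sqrt (real (x i) / p i) * (1 / sqrt (real n))"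
        by (simp add: real_sqrt_divide real_sqrt_mult)
      finally show ?thesis by (simp only: power_mult_distrib)
    qed
    have "exp (1 / 4 * deviance x) = (\<Prod>i=1..k. exp (poisson_deviance (real n * p i) (x i) / 4))"
      unfolding deviance_def by (simp add: sum_distrib_left exp_sum)
    also have "\<dots> = (\<Prod>i=1..k. exp ((real n * p i - real (x i)) / 2)) * (?h x * (\<Prod>i=1..k. (1 / sqrt (real n)) ^ x i))"
      unfolding prod.distrib[symmetric] by (intro prod.cong refl) (simp only: fac)
    also have "(\<Prod>i=1..k. exp ((real n * p i - real (x i)) / 2)) = exp (\<Sum>i=1..k. (real n * p i - real (x i)) / 2)"
      by (simp add: exp_sum)
    also have "(\<Sum>i=1..k. (real n * p i - real (x i)) / 2) = (real n * (\<Sum>i=1..k. p i) - real (\<Sum>i=1..k. x i)) / 2"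
      by (simp add: sum_distrib_left sum_subtractf flip: sum_divide_distrib)
    also have "\<dots> = 0" by (simp only: p_sum x) simp
    also have "(\<Prod>i=1..k. (1 / sqrt (real n)) ^ x i) = (1 / sqrt (real n)) ^ n"
      by (simp only: power_sum[symmetric] x)
    finally show "exp (1 / 4 * deviance x) \<le> (1 / sqrt (real n) ^ n) * ?h x"
      by (simp add: power_one_over)
  qed
  also have "\<dots> = (1 / sqrt (real n) ^ n) * expect ?h" by (rule expect_cmult)
  also have "\<dots> \<le> (1 / sqrt (real n) ^ n) * (2 ^ k * sqrt ((\<Sum>i=1..k. p i) * real n) ^ n)"
    unfolding expect_def by (intro mult_left_mono sample_steps_prod_le p_pos) auto
  also have "\<dots> = 2 ^ k" unfolding p_sum using n_pos by simp
  finally show ?thesis .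
qed

lemma ln_mgf_quarter_le: "ln (mgf (1 / 4)) \<le> real k"
proof -
  have "ln (mgf (1 / 4)) \<le> ln (2 ^ k)" using mgf_quarter_le mgf_pos by (subst ln_le_cancel_iff) auto
  also have "\<dots> = real k * ln 2" by (simp add: ln_realpow)
  also have "\<dots> \<le> real k * 1" using ln_2_less_1 by (intro mult_left_mono) auto
  finally show ?thesis by simp
qed

text \<open>Jensen's inequality for the law tilted by \<open>exp (t deviance)\<close>, in the form of the tangent inequality
  \<open>y \<le> exp (y - c) + c - 1\<close> at the optimal \<open>c\<close>.\<close>

lemma tilted_mean_le:
  "s * mgf' t \<le> mgf t * (ln (mgf (t + s)) - ln (mgf t))"
proof -
  \<comment> \<open>The choice of \<open>c\<close> that makes the two exponential moments below cancel.\<close>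
  define c where "c = ln (mgf (t + s)) - ln (mgf t)"
  have "s * mgf' t = expect (\<lambda>x. s * (deviance x * exp (t * deviance x)))"
    unfolding mgf'_def expect_cmult ..
  also have "\<dots> \<le> expect (\<lambda>x. exp (- c) * exp ((t + s) * deviance x) + (c - 1) * exp (t * deviance x))"
  proof (rule expect_mono)
    fix x
    have "s * deviance x \<le> exp (s * deviance x - c) + (c - 1)" using exp_ge_add_one_self[of "s * deviance x - c"] by linarith
    then have "s * deviance x * exp (t * deviance x) \<le> (exp (s * deviance x - c) + (c - 1)) * exp (t * deviance x)"
      by (intro mult_right_mono) auto
    then show "s * (deviance x * exp (t * deviance x)) \<le> exp (- c) * exp ((t + s) * deviance x) + (c - 1) * exp (t * deviance x)"
      by (simp add: algebra_simps exp_add exp_diff exp_minus divide_inverse)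
  qed
  also have "\<dots> = exp (- c) * mgf (t + s) + (c - 1) * mgf t"
    unfolding mgf_def expect_add expect_cmult ..
  also have "exp (- c) * mgf (t + s) = mgf t"
    using mgf_pos[of t] mgf_pos[of "t + s"] by (simp add: c_def exp_diff)
  finally show ?thesis unfolding c_def[symmetric] by (simp add: algebra_simps)
qed

lemma mean_le: "mgf' 0 \<le> 4 * real k"
  using tilted_mean_le[of "1 / 4" 0] ln_mgf_quarter_le by (simp add: mgf_0)

text \<open>Jensen's inequality, from the tangent of the exponential at the mean.\<close>

lemma ln_mgf_ge: "t * mgf' 0 \<le> ln (mgf t)"
proof -
  define m where "m = mgf' 0"
  have m: "expect deviance = m" by (simp add: m_def mgf'_def)
  have "exp (t * m) = expect (\<lambda>x. exp (t * m) * (t * deviance x) + exp (t * m) * (1 - t * m))"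
    unfolding expect_add expect_cmult expect_const m by (simp add: algebra_simps)
  also have "\<dots> \<le> mgf t"
    unfolding mgf_def
  proof (rule expect_mono)
    fix x
    have "exp (t * m) * (1 + (t * deviance x - t * m)) \<le> exp (t * m) * exp (t * deviance x - t * m)"
      by (intro mult_left_mono exp_ge_add_one_self) auto
    then show "exp (t * m) * (t * deviance x) + exp (t * m) * (1 - t * m) \<le> exp (t * deviance x)"
      by (simp add: exp_diff algebra_simps)
  qed
  finally show ?thesis using mgf_pos by (simp add: ln_ge_iff m_def)
qed

text \<open>The logarithmic derivative at \<open>t\<close> is at most the slope of the chord of \<open>ln mgf\<close> from \<open>t\<close> to \<open>t + 1/8\<close>. Its
  right end is controlled by the crude bound at \<open>1/4\<close>, its left end by the mean.\<close>

lemma mgf'_le: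
  assumes "\<bar>t\<bar> \<le> 1 / 8"
  shows "mgf' t \<le> 12 * real k * mgf t"
proof -
  have "ln (mgf (t + 1 / 8)) \<le> ln (mgf (1 / 4))"
    using assms mgf_pos mgf_mono[of "t + 1 / 8" "1 / 4"] by (subst ln_le_cancel_iff) auto
  then have 1: "ln (mgf (t + 1 / 8)) \<le> real k" using ln_mgf_quarter_le by simp
  have "\<bar>t\<bar> * mgf' 0 \<le> 1 / 8 * (4 * real k)"
    using assms mean_le mean_nonneg by (intro mult_mono) auto
  then have "- (t * mgf' 0) \<le> real k / 2"
    using mean_nonneg abs_ge_minus_self[of "t * mgf' 0"] by (simp add: abs_mult)
  then have 2: "- ln (mgf t) \<le> real k / 2" using ln_mgf_ge[of t] by simp
  have "1 / 8 * mgf' t \<le> mgf t * (ln (mgf (t + 1 / 8)) - ln (mgf t))" by (rule tilted_mean_le)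
  also have "\<dots> \<le> mgf t * (3 / 2 * real k)"
    using 1 2 mgf_pos by (intro mult_left_mono) (auto intro: less_imp_le)
  finally show ?thesis by (simp add: algebra_simps)
qed

lemma deviance_add_sample:
  assumes "a \<in> {1..k}"
  shows "deviance (x(a := Suc (x a))) = deviance x + (poisson_deviance (real n * p a) (Suc (x a)) - poisson_deviance (real n * p a) (x a))"
proof -
  have "(\<Sum>i\<in>{1..k} - {a}. poisson_deviance (real n * p i) ((x(a := Suc (x a))) i)) = (\<Sum>i\<in>{1..k} - {a}. poisson_deviance (real n * p i) (x i))"
    by (intro sum.cong) auto
  then show ?thesis
    unfolding deviance_def using assms by (simp add: sum.remove[of _ a])
qed

text \<open>The differential inequality of the entropy method: subadditivity, then the one-sample bound with the
  deviance before the sample as reference value, then the local estimate in each category. Since no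
  count exceeds \<open>n\<close>, the ratio of a count to its mean \<open>n p\<close> is at most \<open>1 / p\<close>.\<close>

lemma entropy_mgf_le:
  assumes L: "L \<ge> 1" "\<And>i. i \<in> {1..k} \<Longrightarrow> ln (1 / p i) \<le> L" and t: "\<bar>t\<bar> \<le> 1 / (8 * L)"
  shows "t * mgf' t - mgf t * ln (mgf t) \<le> 208 * real k * L * t\<^sup>2 * mgf t"
proof -
  let ?F = "\<lambda>x. exp (t * deviance x)"
  define \<delta> where "\<delta> = (\<lambda>a x. poisson_deviance (real n * p a) (x a) - poisson_deviance (real n * p a) (x a - 1))"
  define R where "R = (\<lambda>a x. ?F x * psi (- (t * \<delta> a x)))"
  define m where "m = n - 1"
  have m: "Suc m = n" using n_pos by (simp add: m_def)
  have "t * mgf' t = expect (\<lambda>x. ?F x * ln (?F x))"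
    unfolding mgf'_def expect_cmult[symmetric] by (simp add: mult_ac)
  then have "t * mgf' t - mgf t * ln (mgf t) = (sample_step k p ^^ Suc m) (\<lambda>x. ?F x * ln (?F x)) (\<lambda>_. 0)
      - (sample_step k p ^^ Suc m) ?F (\<lambda>_. 0) * ln ((sample_step k p ^^ Suc m) ?F (\<lambda>_. 0))"
    unfolding m by (simp only: expect_def mgf_def)
  also have "\<dots> \<le> real (Suc m) * (sample_step k p ^^ m) (ent_step k p ?F) (\<lambda>_. 0)"
    by (rule entropy_subadditive) (use k_pos p_pos in auto)
  also have "\<dots> \<le> real (Suc m) * (sample_step k p ^^ m) (\<lambda>y. \<Sum>a=1..k. p a * R a (y(a := Suc (y a)))) (\<lambda>_. 0)"
  proof (rule mult_left_mono[OF sample_steps_mono])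
    show "0 \<le> p i" if "i \<in> {1..k}" for i using p_pos[OF that] by simp
    fix y :: "nat \<Rightarrow> nat"
    have "ent_step k p ?F y \<le> (\<Sum>a=1..k. p a * (?F (y(a := Suc (y a))) * psi (t * deviance y - t * deviance (y(a := Suc (y a))))))"
      unfolding ent_step_def by (rule ent_exp_le) (use p_pos p_sum in auto)
    also have "\<dots> = (\<Sum>a=1..k. p a * R a (y(a := Suc (y a))))"
    proof (intro sum.cong refl arg_cong2[where f = "(*)"])
      fix a assume a: "a \<in> {1..k}"
      have "t * deviance y - t * deviance (y(a := Suc (y a))) = - (t * \<delta> a (y(a := Suc (y a))))"
        unfolding deviance_add_sample[OF a] \<delta>_def by (simp add: algebra_simps)
      then show "?F (y(a := Suc (y a))) * psi (t * deviance y - t * deviance (y(a := Suc (y a)))) = R a (y(a := Suc (y a)))"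
        unfolding R_def by (simp only:)
    qed
    finally show "ent_step k p ?F y \<le> (\<Sum>a=1..k. p a * R a (y(a := Suc (y a))))" .
  qed simp
  also have "\<dots> = expect (\<lambda>x. \<Sum>a=1..k. real (x a) * R a x)"
    unfolding m expect_def sample_steps_sum_counts by (simp add: m_def)
  also have "\<dots> \<le> expect (\<lambda>x. 16 * t\<^sup>2 * L * (deviance x * ?F x + real k * ?F x))"
  proof (rule expect_mono)
    fix x assume x: "(\<Sum>i=1..k. x i) = n"
    have term_le: "real (x a) * R a x \<le> ?F x * (16 * t\<^sup>2 * L * (poisson_deviance (real n * p a) (x a) + 1))"
      if a: "a \<in> {1..k}" for a
    proof (cases "x a = 0")
      case True
      then show ?thesis using L poisson_deviance_nonneg[OF rate_pos[OF a], of 0] by simp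
    next
      case False
      have "x a \<le> n" using x member_le_sum[of a "{1..k}" x] a by auto
      then have "real (x a) / (real n * p a) \<le> 1 / p a"
        using p_pos[OF a] n_pos by (simp add: field_simps)
      then have "ln (real (x a) / (real n * p a)) \<le> ln (1 / p a)"
        using False p_pos[OF a] rate_pos[OF a] by (subst ln_le_cancel_iff) auto
      then have "ln (real (x a) / (real n * p a)) \<le> L" using L(2)[OF a] by linarith
      then have "real (x a) * psi (- (t * \<delta> a x)) \<le> 16 * t\<^sup>2 * L * (poisson_deviance (real n * p a) (x a) + 1)"
        unfolding \<delta>_def using count_times_psi_increment_le[OF rate_pos[OF a] _ L(1) _ t] False by simp
      then have "?F x * (real (x a) * psi (- (t * \<delta> a x))) \<le> ?F x * (16 * t\<^sup>2 * L * (poisson_deviance (real n * p a) (x a) + 1))"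
        by (intro mult_left_mono) auto
      then show ?thesis unfolding R_def by (simp only: mult_ac)
    qed
    have "(\<Sum>a=1..k. real (x a) * R a x) \<le> (\<Sum>a=1..k. ?F x * (16 * t\<^sup>2 * L * (poisson_deviance (real n * p a) (x a) + 1)))"
      by (intro sum_mono term_le)
    also have "\<dots> = ?F x * (16 * t\<^sup>2 * L * (deviance x + real k))"
      unfolding sum_distrib_left[symmetric] deviance_def by (simp add: sum.distrib)
    finally show "(\<Sum>a=1..k. real (x a) * R a x) \<le> 16 * t\<^sup>2 * L * (deviance x * ?F x + real k * ?F x)"
      by (simp add: algebra_simps)
  qed
  also have "\<dots> = 16 * t\<^sup>2 * L * (mgf' t + real k * mgf t)"
    unfolding expect_cmult expect_add mgf_def mgf'_def ..
  also have "\<dots> \<le> 16 * t\<^sup>2 * L * (12 * real k * mgf t + real k * mgf t)"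
  proof (intro mult_left_mono add_right_mono mgf'_le)
    have "1 / (8 * L) \<le> 1 / 8" using L by simp
    then show "\<bar>t\<bar> \<le> 1 / 8" using t by linarith
  qed (use L in auto)
  finally show ?thesis by (simp add: algebra_simps)
qed

text \<open>Negative \<open>t\<close> are covered by Herbst's argument for \<open>t \<mapsto> ln (mgf (- t))\<close>.\<close>

lemma ln_mgf_small:
  assumes L: "L \<ge> 1" "\<And>i. i \<in> {1..k} \<Longrightarrow> ln (1 / p i) \<le> L" and t: "\<bar>t\<bar> \<le> 1 / (8 * L)"
  shows "ln (mgf t) \<le> t * mgf' 0 + 208 * real k * L * t\<^sup>2"
proof -
  define K where "K = (\<lambda>t. ln (mgf t))"
  define K' where "K' = (\<lambda>t. mgf' t / mgf t)"
  have K0: "K 0 = 0" and K'0: "K' 0 = mgf' 0" by (simp_all add: K_def K'_def mgf_0)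
  have deriv: "(K has_real_derivative K' t) (at t)" for t
    unfolding K_def K'_def using mgf_pos[of t]
    by (auto intro!: derivative_eq_intros mgf_DERIV)
  have ineq: "s * K' s - K s \<le> 208 * real k * L * s\<^sup>2" if "\<bar>s\<bar> \<le> 1 / (8 * L)" for s
  proof -
    have "mgf s * (s * K' s - K s) \<le> mgf s * (208 * real k * L * s\<^sup>2)"
      using entropy_mgf_le[OF L that] mgf_pos[of s] by (simp add: K'_def K_def algebra_simps)
    then show ?thesis using mgf_pos[of s] by simp
  qed
  show ?thesis
  proof (cases "t \<ge> 0")
    case True
    have "K t \<le> K' 0 * t + 208 * real k * L * t\<^sup>2"
      by (rule herbst_argument[OF deriv K0, where r = "1 / (8 * L)"]) (use ineq t True in auto)
    then show ?thesis by (simp add: K_def K'0 mult.commute)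
  next
    case False
    have deriv': "((\<lambda>s. K (- s)) has_real_derivative - K' (- s)) (at s)" for s
    proof -
      have "((\<lambda>s. K (- s)) has_real_derivative K' (- s) * (- 1)) (at s)"
        by (rule DERIV_chain2[where f = K and g = uminus]) (auto intro!: derivative_eq_intros deriv)
      then show ?thesis by simp
    qed
    have "K (- (- t)) \<le> - K' (- 0) * (- t) + 208 * real k * L * (- t)\<^sup>2"
    proof (rule herbst_argument[OF deriv', where r = "1 / (8 * L)"])
      show "s * - K' (- s) - K (- s) \<le> 208 * real k * L * s\<^sup>2" if "0 < s" "s \<le> 1 / (8 * L)" for s
        using ineq[of "- s"] that by simp
    qed (use K0 t False in auto)
    then show ?thesis by (simp add: K_def K'0 mult.commute)
  qed
qed

text \<open>For \<open>\<bar>t\<bar> > 1 / (8 L)\<close> the right-hand side is at least \<open>k\<close>, and the crude bounds on \<open>mgf (1/4)\<close> and on the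
  mean suffice.\<close>

lemma ln_mgf_centered_le:
  assumes L: "L \<ge> 1" "\<And>i. i \<in> {1..k} \<Longrightarrow> ln (1 / p i) \<le> L" and t: "\<bar>t\<bar> \<le> 1 / 8"
  shows "ln (mgf t) - t * mgf' 0 \<le> 208 * real k * L ^ 4 * t\<^sup>2"
proof (cases "\<bar>t\<bar> \<le> 1 / (8 * L)")
  case True
  have "L ^ 1 \<le> L ^ 4" using L by (intro power_increasing) auto
  then have "208 * real k * L * t\<^sup>2 \<le> 208 * real k * L ^ 4 * t\<^sup>2"
    by (intro mult_right_mono mult_left_mono) auto
  then show ?thesis using ln_mgf_small[OF L True] by linarith
next
  case False
  have "1 / 8 \<le> \<bar>t\<bar> * L" using False L by (simp add: field_simps)
  then have "(1 / 8)\<^sup>2 \<le> (\<bar>t\<bar> * L)\<^sup>2" by (intro power_mono) auto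
  also have "\<dots> = L ^ 2 * t\<^sup>2" by (simp add: power_mult_distrib)
  also have "\<dots> \<le> L ^ 4 * t\<^sup>2" using L by (intro mult_right_mono power_increasing) auto
  finally have "1 / 64 \<le> L ^ 4 * t\<^sup>2" by (simp add: power2_eq_square)
  then have "208 * real k * (1 / 64) \<le> 208 * real k * (L ^ 4 * t\<^sup>2)" by (intro mult_left_mono) auto
  moreover have "real k \<le> 208 * real k * (1 / 64)" by simp
  ultimately have big: "real k \<le> 208 * real k * L ^ 4 * t\<^sup>2" unfolding mult.assoc by linarith
  show ?thesis
  proof (cases "t \<ge> 0")
    case True
    have "ln (mgf t) \<le> ln (mgf (1 / 4))"
      using t mgf_pos mgf_mono[of t "1 / 4"] by (subst ln_le_cancel_iff) auto
    moreover have "t * mgf' 0 \<ge> 0" using True mean_nonneg by simp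
    ultimately show ?thesis using ln_mgf_quarter_le big by linarith
  next
    case False
    have "ln (mgf t) \<le> ln (mgf 0)"
      using False mgf_pos mgf_mono[of t 0] by (subst ln_le_cancel_iff) auto
    moreover have "- t * mgf' 0 \<le> 1 / 8 * (4 * real k)"
      using t False mean_le mean_nonneg by (intro mult_mono) auto
    ultimately show ?thesis using big by (simp add: mgf_0)
  qed
qed

lemma Z_stat_eq_deviance:
  assumes x: "(\<Sum>i=1..k. x i) = n"
  shows "Z_stat n k p x = deviance x"
proof -
  have term_eq: "2 * real n * (if empirical n x i = 0 then 0 else empirical n x i * ln (empirical n x i / p i))
      = poisson_deviance (real n * p i) (x i) + 2 * (real (x i) - real n * p i)" if "i \<in> {1..k}" for i
    using n_pos by (simp add: empirical_def poisson_deviance_def)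
  have "Z_stat n k p x = (\<Sum>i=1..k. poisson_deviance (real n * p i) (x i) + 2 * (real (x i) - real n * p i))"
    unfolding Z_stat_def rel_entropy_def sum_distrib_left by (intro sum.cong refl term_eq)
  also have "\<dots> = deviance x + 2 * (real (\<Sum>i=1..k. x i) - real n * (\<Sum>i=1..k. p i))"
    unfolding deviance_def by (simp add: sum.distrib sum_subtractf sum_distrib_left right_diff_distrib)
  also have "\<dots> = deviance x" by (simp only: x p_sum) simp
  finally show ?thesis .
qed

lemma in_prob_simplex: "p \<in> prob_simplex k"
  using p_pos p_sum by (auto simp: prob_simplex_def intro: less_imp_le)

lemma expectation_eq_expect:
  assumes "\<And>x. (\<Sum>i=1..k. x i) = n \<Longrightarrow> f x = g x"
  shows "measure_pmf.expectation (multinomial_pmf n k p) f = expect g"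
  unfolding expectation_multinomial[OF in_prob_simplex] expect_def
  by (rule sample_steps_cong) (simp add: assms)

lemma ln_expectation_exp_centered_le:
  assumes "L \<ge> 1" "\<And>i. i \<in> {1..k} \<Longrightarrow> ln (1 / p i) \<le> L" "\<bar>t\<bar> \<le> 1 / 8"
  shows "ln (measure_pmf.expectation (multinomial_pmf n k p)
      (\<lambda>X. exp (t * (Z_stat n k p X - measure_pmf.expectation (multinomial_pmf n k p) (Z_stat n k p)))))
    \<le> 208 * real k * L ^ 4 * t\<^sup>2"
proof -
  have mean: "measure_pmf.expectation (multinomial_pmf n k p) (Z_stat n k p) = mgf' 0"
    unfolding mgf'_def by (rule expectation_eq_expect) (simp add: Z_stat_eq_deviance)
  have "measure_pmf.expectation (multinomial_pmf n k p) (\<lambda>X. exp (t * (Z_stat n k p X - mgf' 0)))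
      = expect (\<lambda>x. exp (- (t * mgf' 0)) * exp (t * deviance x))"
    by (rule expectation_eq_expect) (simp add: Z_stat_eq_deviance algebra_simps flip: exp_add)
  also have "\<dots> = exp (- (t * mgf' 0)) * mgf t"
    unfolding expect_cmult mgf_def ..
  finally show ?thesis
    unfolding mean using ln_mgf_centered_le[OF assms] mgf_pos[of t] by (simp add: ln_mult_pos)
qed

end

theorem theorem1:
  shows "\<exists>C c :: real. C > 0 \<and> c > 0 \<and>
    (\<forall>(n::nat) (k::nat) (\<alpha>::real) (p :: nat \<Rightarrow> real).
      n \<ge> 1 \<longrightarrow> k \<ge> 2 \<longrightarrow> \<alpha> > 0 \<longrightarrow> p \<in> prob_simplex_ge k \<alpha> \<longrightarrow>
      (\<forall>t::real. \<bar>t\<bar> \<le> 1 / c \<longrightarrow>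
        ln (measure_pmf.expectation (multinomial_pmf n k p)
              (\<lambda>X. exp (t * (Z_stat n k p X
                 - measure_pmf.expectation (multinomial_pmf n k p) (Z_stat n k p)))))
        \<le> C * real k * (ln (real k / \<alpha>)) ^ 4 * t\<^sup>2))"
proof (rule exI[of _ 208], rule exI[of _ 8], intro conjI allI impI)
  fix n k :: nat and \<alpha> :: real and p :: "nat \<Rightarrow> real" and t :: real
  assume n: "n \<ge> 1" and k: "k \<ge> 2" and \<alpha>: "\<alpha> > 0" and p: "p \<in> prob_simplex_ge k \<alpha>" and t: "\<bar>t\<bar> \<le> 1 / 8"
  have ge: "\<alpha> \<le> p i" if "i \<in> {1..k}" for i
    using p that Min_le[of "p ` {1..k}" "p i"] by (simp add: prob_simplex_ge_def)
  have sum: "(\<Sum>i=1..k. p i) = 1" using p by (simp add: prob_simplex_ge_def prob_simplex_def)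
  interpret multinomial_sampling n k p
  proof
    show "0 < p i" if "i \<in> {1..k}" for i using ge[OF that] \<alpha> by simp
  qed (use n k sum in auto)
  have "real k * \<alpha> \<le> 1"
    using sum_mono[of "{1..k}" "\<lambda>_. \<alpha>" p] ge sum by simp
  then have inv: "real k \<le> 1 / \<alpha>" using \<alpha> by (simp add: field_simps)
  show "ln (measure_pmf.expectation (multinomial_pmf n k p)
          (\<lambda>X. exp (t * (Z_stat n k p X - measure_pmf.expectation (multinomial_pmf n k p) (Z_stat n k p)))))
      \<le> 208 * real k * (ln (real k / \<alpha>)) ^ 4 * t\<^sup>2"
  proof (rule ln_expectation_exp_centered_le[OF _ _ t])
    have "exp 1 \<le> (3 :: real)" by (rule exp_le)
    also have "\<dots> \<le> 2 * 2" by simp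
    also have "\<dots> \<le> real k * (1 / \<alpha>)" using k inv by (intro mult_mono) auto
    finally show "ln (real k / \<alpha>) \<ge> 1" using k \<alpha> by (subst ln_ge_iff) auto
    show "ln (1 / p i) \<le> ln (real k / \<alpha>)" if "i \<in> {1..k}" for i
    proof -
      have pi: "0 < p i" using p_pos[OF that] .
      have "1 / p i \<le> real k / \<alpha>" using k \<alpha> ge[OF that] pi by (intro frac_le) auto
      then show ?thesis using pi k \<alpha> by (subst ln_le_cancel_iff) auto
    qed
  qed
qed auto

end
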